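(* Let $s_1,s_2>1$ satisfy $\frac1{s_1}+\frac1{s_2}=1$ and let $r>0$. There exists $a_0>0$ (depending on $s_1,s_2,r$) such that the following holds for every $a\in(0,a_0)$ satisfying $$(s_1+2rs_1a)^m=\frac{1}{4r^2s_2^2a^2}$$ for some integer $m\ge 1$ (i.e., the map $W_a$ is Markov with $W_a^{m+1}(1/2)=\frac12-\frac1{2s_1}$). The Frobenius–Perron operator $P_a$ of $W_a$, acting on functions of bounded variation on $[0,1]$, has an eigenvalue $\lambda=\lambda_a$ satisfying $$\frac{1-2ra}{1+2ra}<\lambda_a<\frac{1}{1+2ra}.$$ The corresponding eigenfunction is, up to a multiplicative constant, $$h_m=c+\alpha_0\chi_{I_0}+\alpha_1\chi_{I_1}+\cdots+\alpha_m\chi_{I_m},$$ where $$\alpha_j=\lambda^{m-j}s_1^{m-j}(1+2ra)^{m-j}\quad (j=1,\dots,m),$$ $$\alpha_0=\frac{\lambda^{m}s_1^{m-1}(1+2ra)^{m}\bigl(\lambda s_1s_2(1+2ra)-s_1s_2\bigr)+1}{\lambda s_1(1+2ra)-1},$$ $$c=\frac{\alpha_0}{s_2(2\lambda-1)}=\lambda(1+2ra)\alpha_0-\frac{\alpha_0}{s_1}-\frac1{s_1}.$$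
   Context: For $s_1,s_2>1$ with $\frac1{s_1}+\frac1{s_2}=1$, $r>0$ and $0<a\le\frac1{2r}$, the map $W_a:[0,1]\to[0,1]$ is $$W_a(x)=\begin{cases}W_{a,1}(x)=1-2s_2x, & 0\le x<\frac12-\frac1{2s_1},\\ W_{a,2}(x)=(s_1+2rs_1a)\left(x-\frac12+\frac1{2s_1}\right), & \frac12-\frac1{2s_1}\le x<\frac12,\\ W_{a,3}(x)=(s_2+2rs_2a)\left(\frac12+\frac1{2s_2}-x\right), & \frac12\le x<\frac12+\frac1{2s_2},\\ W_{a,4}(x)=2s_1(x-1)+1, & \frac12+\frac1{2s_2}\le x\le1.\end{cases}$$ Note that $W_a(\frac12)=\frac12+ra$ and $\frac12-\frac1{2s_1}=\frac1{2s_2}$. Intervals: $I_0=[0,\frac12+ra]$ and $I_i=[W_a^i(\frac12+ra),\frac12+ra]$ for $i=1,\dots,m$; $\chi_I$ denotes the characteristic function of $I$. With $\tau_i=W_{a,i}^{-1}$, the Frobenius–Perron operator of $W_a$ (with respect to Lebesgue measure) is $$P_af=\frac1{2s_2}f\circ\tau_1+\frac1{s_1+2rs_1a}(f\circ\tau_2)\chi_{I_0}+\frac1{s_2+2rs_2a}(f\circ\tau_3)\chi_{I_0}+\frac1{2s_1}f\circ\tau_4.$$ It is considered on the space of functions of bounded variation on $[0,1]$, with functions identified if they agree Lebesgue-almost everywhere. *)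

theory Defs
  imports "HOL-Analysis.Analysis"
begin

definition W1 :: "real \<Rightarrow> real \<Rightarrow> real"
  where "W1 s2 x = 1 - 2 * s2 * x"

definition W2 :: "real \<Rightarrow> real \<Rightarrow> real \<Rightarrow> real \<Rightarrow> real"
  where "W2 s1 r a x = (s1 + 2 * r * s1 * a) * (x - 1/2 + 1 / (2 * s1))"

definition W3 :: "real \<Rightarrow> real \<Rightarrow> real \<Rightarrow> real \<Rightarrow> real"
  where "W3 s2 r a x = (s2 + 2 * r * s2 * a) * (1/2 + 1 / (2 * s2) - x)"

definition W4 :: "real \<Rightarrow> real \<Rightarrow> real"
  where "W4 s1 x = 2 * s1 * (x - 1) + 1"

text \<open>The map of interest is the restriction of \<open>W s1 s2 r a\<close> to the unit interval, which it maps
  into itself if \<open>1 / s1 + 1 / s2 = 1\<close> and \<open>0 < a \<le> 1 / (2 * r)\<close>; its values elsewhere are irrelevant.\<close>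

definition W :: "real \<Rightarrow> real \<Rightarrow> real \<Rightarrow> real \<Rightarrow> real \<Rightarrow> real"
  where "W s1 s2 r a x =
    (if x < 1/2 - 1 / (2 * s1) then W1 s2 x
     else if x < 1/2 then W2 s1 r a x
     else if x < 1/2 + 1 / (2 * s2) then W3 s2 r a x
     else W4 s1 x)"

definition I_set :: "real \<Rightarrow> real \<Rightarrow> real \<Rightarrow> real \<Rightarrow> nat \<Rightarrow> real set"
  where "I_set s1 s2 r a i =
    (if i = 0 then {0 .. 1/2 + r * a}
     else {(W s1 s2 r a ^^ i) (1/2 + r * a) .. 1/2 + r * a})"

text \<open>The branches are affine bijections of the real line, so \<open>inv\<close> yields affine functions
  extending the inverse branches. On the unit interval (branches 1 and 4), respectively on
  \<open>I_set s1 s2 r a 0\<close> (branches 2 and 3), they take values in the closures of the corresponding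
  pieces; outside \<open>I_set s1 s2 r a 0\<close> the contributions of branches 2 and 3 are cut off.\<close>

definition FP :: "real \<Rightarrow> real \<Rightarrow> real \<Rightarrow> real \<Rightarrow> (real \<Rightarrow> real) \<Rightarrow> real \<Rightarrow> real"
  where "FP s1 s2 r a f x =
      1 / (2 * s2) * f (inv (W1 s2) x)
    + 1 / (s1 + 2 * r * s1 * a) * f (inv (W2 s1 r a) x) * indicator (I_set s1 s2 r a 0) x
    + 1 / (s2 + 2 * r * s2 * a) * f (inv (W3 s2 r a) x) * indicator (I_set s1 s2 r a 0) x
    + 1 / (2 * s1) * f (inv (W4 s1) x)"

definition bounded_variation_on :: "real \<Rightarrow> real \<Rightarrow> (real \<Rightarrow> real) \<Rightarrow> bool"
  where "bounded_variation_on u v f \<longleftrightarrow>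
    (\<exists>B. \<forall>(n::nat) (x :: nat \<Rightarrow> real).
       (\<forall>i\<le>n. x i \<in> {u..v}) \<longrightarrow> (\<forall>i<n. x i \<le> x (Suc i)) \<longrightarrow>
       (\<Sum>i<n. \<bar>f (x (Suc i)) - f (x i)\<bar>) \<le> B)"

definition ae_eq :: "(real \<Rightarrow> real) \<Rightarrow> (real \<Rightarrow> real) \<Rightarrow> bool"
  where "ae_eq f g \<longleftrightarrow> (AE x in lebesgue_on {0..1}. f x = g x)"

text \<open>Elements of the function space are represented by functions of bounded variation on the unit
  interval, all identities between them being understood modulo \<open>ae_eq\<close>.\<close>

definition eigenfunction :: "((real \<Rightarrow> real) \<Rightarrow> real \<Rightarrow> real) \<Rightarrow> real \<Rightarrow> (real \<Rightarrow> real) \<Rightarrow> bool"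
  where "eigenfunction P lam f \<longleftrightarrow>
    bounded_variation_on 0 1 f \<and> \<not> ae_eq f (\<lambda>_. 0) \<and> ae_eq (P f) (\<lambda>x. lam * f x)"

definition eigenvalue :: "((real \<Rightarrow> real) \<Rightarrow> real \<Rightarrow> real) \<Rightarrow> real \<Rightarrow> bool"
  where "eigenvalue P lam \<longleftrightarrow> (\<exists>f. eigenfunction P lam f)"

definition alpha :: "real \<Rightarrow> real \<Rightarrow> real \<Rightarrow> nat \<Rightarrow> real \<Rightarrow> nat \<Rightarrow> real"
  where "alpha s1 r a m lam j = lam ^ (m - j) * s1 ^ (m - j) * (1 + 2 * r * a) ^ (m - j)"

definition alpha0 :: "real \<Rightarrow> real \<Rightarrow> real \<Rightarrow> real \<Rightarrow> nat \<Rightarrow> real \<Rightarrow> real"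
  where "alpha0 s1 s2 r a m lam =
    (lam ^ m * s1 ^ (m - 1) * (1 + 2 * r * a) ^ m * (lam * s1 * s2 * (1 + 2 * r * a) - s1 * s2) + 1)
    / (lam * s1 * (1 + 2 * r * a) - 1)"

definition c_coeff :: "real \<Rightarrow> real \<Rightarrow> real \<Rightarrow> real \<Rightarrow> nat \<Rightarrow> real \<Rightarrow> real"
  where "c_coeff s1 s2 r a m lam = alpha0 s1 s2 r a m lam / (s2 * (2 * lam - 1))"

definition h :: "real \<Rightarrow> real \<Rightarrow> real \<Rightarrow> real \<Rightarrow> nat \<Rightarrow> real \<Rightarrow> real \<Rightarrow> real"
  where "h s1 s2 r a m lam x =
      c_coeff s1 s2 r a m lam
    + alpha0 s1 s2 r a m lam * indicator (I_set s1 s2 r a 0) x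
    + (\<Sum>j=1..m. alpha s1 r a m lam j * indicator (I_set s1 s2 r a j) x)"

end

theory Submission
  imports Defs "HOL-Real_Asymp.Real_Asymp"
begin

text \<open>
  Put \<open>d = r a\<close>, \<open>b = 1 + 2 d\<close> and let \<open>p = b / 2 = 1/2 + d\<close> be the image of the turning point \<open>1/2\<close>.

  \<^emph>\<open>The eigenfunction.\<close>
  The intervals \<open>I\<^sub>j\<close> all end at \<open>p\<close>; for \<open>j \<ge> 1\<close> they begin at the points of the orbit of \<open>p\<close>. The first point
  \<open>W p\<close> lies just below the fixed point of the second branch, at a distance of order \<open>d\<^sup>2\<close>; the
  second branch multiplies this distance by \<open>s1 b\<close>, and the Markov condition says exactly that the
  \<open>m\<close>-th point is the left end \<open>1 / (2 s2)\<close> of that branch (\<open>orbit\<close>, \<open>orbit_last\<close>). Hence the operator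
  maps the span of \<open>1\<close> and the \<open>\<chi>\<close> of \<open>I\<^sub>0, \<dots>, I\<^sub>m\<close> into itself, and comparing coefficients gives
  the stated values of \<open>\<alpha>\<^sub>j\<close>, \<open>\<alpha>\<^sub>0\<close> and \<open>c\<close>. One equation is left over: the two expressions for
  \<open>c\<close> must agree. If they do, \<open>h\<^sub>m\<close> is an eigenfunction (\<open>FP_hm\<close>, \<open>hm_eigenfunction\<close>).

  \<^emph>\<open>The eigenvalue.\<close>
  The difference of the two expressions for \<open>c\<close> is continuous in \<open>\<lambda>\<close>, positive at \<open>\<lambda> = 1 / b\<close>, and
  tends to \<open>- 4 / (s1 s2)\<close> at \<open>\<lambda> = (1 - 2 d) / b\<close> as \<open>a\<close> tends to \<open>0\<close>. The latter uses that
  \<open>m\<close> grows only like \<open>ln (1 / d)\<close>, so that \<open>\<lambda> ^ m\<close> tends to \<open>1\<close> (\<open>lower_end_power_bound\<close>). The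
  intermediate value theorem gives \<open>\<lambda>\<close> (\<open>secular_root_exists\<close>).

  \<^emph>\<open>Simplicity.\<close>
  Let \<open>f\<close> be any eigenfunction. Every branch stretches by at least \<open>1 / \<theta>\<close> with \<open>\<theta> < \<lambda>\<close>, so the
  operator would multiply variations by at most \<open>\<theta>\<close>, were it not for the jump that it creates at \<open>p\<close>,
  of size \<open>f(1/2 -) / (s1 b) + f(1/2 +) / (s2 b)\<close>. As \<open>h\<^sub>m\<close> is a nonzero constant near \<open>1/2\<close>,
  this jump vanishes for \<open>g = f - k h\<^sub>m\<close> with a suitable \<open>k\<close>. Then \<open>\<lambda> Var g \<le> \<theta> Var g\<close>, so \<open>g\<close> is
  constant, and a constant without jump at \<open>p\<close> is \<open>0\<close> (\<open>balanced_variation_contraction\<close>,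
  \<open>eigenfunction_unique\<close>).
  Since all identities hold only almost everywhere, variations are taken over points of a set of full
  measure that is invariant under the inverse branches.
\<close>

section \<open>Variation along finite lists of points\<close>

text \<open>
  The simplicity proof glues preimages of one chain of points under the four branches into a longer
  chain, reversing the order on two of them. With lists these operations are \<open>@\<close> and \<open>rev\<close>.
\<close>

fun list_variation :: "(real \<Rightarrow> real) \<Rightarrow> real list \<Rightarrow> real" where
  "list_variation f (x # y # zs) = \<bar>f y - f x\<bar> + list_variation f (y # zs)"
| "list_variation f [x] = 0"
| "list_variation f [] = 0"

lemma list_variation_nonneg: "0 \<le> list_variation f xs"
  by (induction f xs rule: list_variation.induct) auto

lemma list_variation_Cons_ge: "list_variation f xs \<le> list_variation f (x # xs)"
  by (cases xs) auto

lemma list_variation_append_ge: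
  "list_variation f xs + list_variation f ys \<le> list_variation f (xs @ ys)"
  by (induction f xs rule: list_variation.induct) (auto simp: list_variation_Cons_ge)

lemma list_variation_snoc:
  "list_variation f (xs @ [y, x]) = list_variation f (xs @ [y]) + \<bar>f x - f y\<bar>"
proof (induction xs)
  case (Cons a xs)
  then show ?case by (cases xs) auto
qed auto

lemma list_variation_rev: "list_variation f (rev xs) = list_variation f xs"
  by (induction f xs rule: list_variation.induct) (auto simp: list_variation_snoc)

lemma list_variation_map: "list_variation f (map g xs) = list_variation (\<lambda>x. f (g x)) xs"
  by (induction f xs rule: list_variation.induct) auto

lemma list_variation_cong:
  "(\<And>x. x \<in> set xs \<Longrightarrow> f x = g x) \<Longrightarrow> list_variation f xs = list_variation g xs"
  by (induction f xs rule: list_variation.induct) auto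

lemma list_variation_add_le:
  "list_variation (\<lambda>x. f x + g x) xs \<le> list_variation f xs + list_variation g xs"
  by (induction f xs rule: list_variation.induct) auto

lemma list_variation_cmult:
  "list_variation (\<lambda>x. c * f x) xs = \<bar>c\<bar> * list_variation f xs"
  by (induction f xs rule: list_variation.induct)
    (auto simp: distrib_left simp flip: abs_mult right_diff_distrib)

lemma list_variation_le_sup:
  "(\<And>x. x \<in> set xs \<Longrightarrow> \<bar>f x\<bar> \<le> e) \<Longrightarrow> list_variation f xs \<le> 2 * e * real (length xs)"
proof (induction f xs rule: list_variation.induct)
  case (1 f x y zs)
  then have "list_variation f (y # zs) \<le> 2 * e * real (length (y # zs))" by auto
  moreover have "\<bar>f x\<bar> \<le> e" "\<bar>f y\<bar> \<le> e" using 1(2)[of x] 1(2)[of y] by auto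
  ultimately show ?case by (auto simp: algebra_simps)
next
  case (2 f x)
  then have "\<bar>f x\<bar> \<le> e" by auto
  then show ?case by auto
qed auto

lemma list_variation_eq_sum:
  "list_variation f xs = (\<Sum>i<length xs - 1. \<bar>f (xs ! Suc i) - f (xs ! i)\<bar>)"
  by (induction f xs rule: list_variation.induct) (auto simp: sum.lessThan_Suc_shift simp del: sum.lessThan_Suc)

section \<open>Functions of bounded variation\<close>
lemma bounded_variation_on_imp_list_bound:
  assumes "bounded_variation_on u v f"
  obtains B where "\<And>xs. sorted xs \<Longrightarrow> set xs \<subseteq> {u..v} \<Longrightarrow> list_variation f xs \<le> B"
proof -
  obtain B where B: "\<And>(n::nat) x. (\<forall>i\<le>n. x i \<in> {u..v}) \<Longrightarrow> (\<forall>i<n. x i \<le> x (Suc i)) \<Longrightarrow>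
       (\<Sum>i<n. \<bar>f (x (Suc i)) - f (x i)\<bar>) \<le> B"
    using assms unfolding bounded_variation_on_def by blast
  have "list_variation f xs \<le> max B 0" if "sorted xs" "set xs \<subseteq> {u..v}" for xs
  proof (cases "xs = []")
    case False
    then have "list_variation f xs \<le> B"
      unfolding list_variation_eq_sum
    proof (intro B allI impI)
      fix i assume "i \<le> length xs - 1"
      then have "xs ! i \<in> set xs" using False by (intro nth_mem) (auto simp: Suc_le_eq neq_Nil_conv)
      then show "xs ! i \<in> {u..v}" using that by blast
    qed (use that in \<open>auto simp: sorted_iff_nth_Suc\<close>)
    then show ?thesis by simp
  qed auto
  then show thesis using that by blast
qed

lemma bounded_variation_on_add:
  assumes "bounded_variation_on u v f" "bounded_variation_on u v g"
  shows "bounded_variation_on u v (\<lambda>x. f x + g x)"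
proof -
  obtain B where B: "\<And>(n::nat) x. (\<forall>i\<le>n. x i \<in> {u..v}) \<Longrightarrow> (\<forall>i<n. x i \<le> x (Suc i)) \<Longrightarrow>
       (\<Sum>i<n. \<bar>f (x (Suc i)) - f (x i)\<bar>) \<le> B"
    using assms unfolding bounded_variation_on_def by blast
  obtain C where C: "\<And>(n::nat) x. (\<forall>i\<le>n. x i \<in> {u..v}) \<Longrightarrow> (\<forall>i<n. x i \<le> x (Suc i)) \<Longrightarrow>
       (\<Sum>i<n. \<bar>g (x (Suc i)) - g (x i)\<bar>) \<le> C"
    using assms unfolding bounded_variation_on_def by blast
  have "(\<Sum>i<n. \<bar>f (x (Suc i)) + g (x (Suc i)) - (f (x i) + g (x i))\<bar>) \<le> B + C"
    if "\<forall>i\<le>n. x i \<in> {u..v}" "\<forall>i<n. x i \<le> x (Suc i)" for n :: nat and x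
  proof -
    have "(\<Sum>i<n. \<bar>f (x (Suc i)) + g (x (Suc i)) - (f (x i) + g (x i))\<bar>)
      \<le> (\<Sum>i<n. \<bar>f (x (Suc i)) - f (x i)\<bar> + \<bar>g (x (Suc i)) - g (x i)\<bar>)"
      by (intro sum_mono) linarith
    also have "\<dots> \<le> B + C"
      using B[OF that] C[OF that] by (simp add: sum.distrib)
    finally show ?thesis .
  qed
  then show ?thesis unfolding bounded_variation_on_def by blast
qed

lemma bounded_variation_on_cmult:
  assumes "bounded_variation_on u v f"
  shows "bounded_variation_on u v (\<lambda>x. c * f x)"
proof -
  obtain B where B: "\<And>(n::nat) x. (\<forall>i\<le>n. x i \<in> {u..v}) \<Longrightarrow> (\<forall>i<n. x i \<le> x (Suc i)) \<Longrightarrow>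
       (\<Sum>i<n. \<bar>f (x (Suc i)) - f (x i)\<bar>) \<le> B"
    using assms unfolding bounded_variation_on_def by blast
  have "(\<Sum>i<n. \<bar>c * f (x (Suc i)) - c * f (x i)\<bar>) \<le> \<bar>c\<bar> * B"
    if "\<forall>i\<le>n. x i \<in> {u..v}" "\<forall>i<n. x i \<le> x (Suc i)" for n :: nat and x
  proof -
    have "(\<Sum>i<n. \<bar>c * f (x (Suc i)) - c * f (x i)\<bar>) = \<bar>c\<bar> * (\<Sum>i<n. \<bar>f (x (Suc i)) - f (x i)\<bar>)"
      by (simp add: sum_distrib_left flip: abs_mult right_diff_distrib)
    then show ?thesis using B[OF that] by (simp add: mult_left_mono)
  qed
  then show ?thesis unfolding bounded_variation_on_def by blast
qed

lemma bounded_variation_on_mono: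
  assumes "mono f"
  shows "bounded_variation_on u v f"
  unfolding bounded_variation_on_def
proof (intro exI allI impI)
  fix n :: nat and x :: "nat \<Rightarrow> real"
  assume x: "\<forall>i\<le>n. x i \<in> {u..v}" "\<forall>i<n. x i \<le> x (Suc i)"
  have "(\<Sum>i<n. \<bar>f (x (Suc i)) - f (x i)\<bar>) = (\<Sum>i<n. f (x (Suc i)) - f (x i))"
    using x(2) assms by (intro sum.cong) (auto simp: mono_def)
  also have "\<dots> = f (x n) - f (x 0)" by (rule sum_lessThan_telescope)
  also have "\<dots> \<le> f v - f u" using x(1) assms by (auto simp: mono_def intro!: diff_mono)
  finally show "(\<Sum>i<n. \<bar>f (x (Suc i)) - f (x i)\<bar>) \<le> f v - f u" .
qed

lemma bounded_variation_on_indicator: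
  "bounded_variation_on u v (\<lambda>x. indicator {b..e::real} x)"
proof (cases "b \<le> e")
  case True
  have *: "(\<lambda>x. indicator {b..e} x) = (\<lambda>x. indicator {b..} x + (- 1) * (indicator {e<..} x :: real))"
    using True by (auto simp: indicator_def fun_eq_iff)
  show ?thesis unfolding *
    by (intro bounded_variation_on_add bounded_variation_on_cmult bounded_variation_on_mono)
      (auto simp: mono_def indicator_def)
next
  case False
  then show ?thesis by (auto simp: bounded_variation_on_def)
qed

lemma bounded_variation_on_const: "bounded_variation_on u v (\<lambda>x. c)"
  by (auto simp: bounded_variation_on_def)

lemma bounded_variation_on_sum:
  assumes "finite A" "\<And>i. i \<in> A \<Longrightarrow> bounded_variation_on u v (f i)"
  shows "bounded_variation_on u v (\<lambda>x. \<Sum>i\<in>A. f i x)"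
  using assms
  by (induction A rule: finite_induct) (auto intro: bounded_variation_on_add bounded_variation_on_const)

lemma bounded_variation_on_imp_bounded:
  assumes "bounded_variation_on u v f" "u \<le> v"
  obtains M where "\<And>x. x \<in> {u..v} \<Longrightarrow> \<bar>f x\<bar> \<le> M"
proof -
  obtain B where B: "\<And>xs. sorted xs \<Longrightarrow> set xs \<subseteq> {u..v} \<Longrightarrow> list_variation f xs \<le> B"
    using bounded_variation_on_imp_list_bound[OF assms(1)] by blast
  have "\<bar>f x\<bar> \<le> B + \<bar>f u\<bar>" if "x \<in> {u..v}" for x
    using B[of "[u, x]"] that by auto
  then show thesis using that by blast
qed

section \<open>Sets of full measure\<close>

text \<open>Lebesgue measure is complete, so the exceptional set itself is measurable.\<close>
lemma ae_eq_iff_negligible: "ae_eq f g \<longleftrightarrow> negligible {x \<in> {0..1}. f x \<noteq> g x}"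
proof -
  have "ae_eq f g \<longleftrightarrow> (AE x in lebesgue. x \<in> {0..1} \<longrightarrow> f x = g x)"
    unfolding ae_eq_def by (subst AE_restrict_space_iff) auto
  also have "\<dots> \<longleftrightarrow> negligible {x \<in> {0..1}. f x \<noteq> g x}"
    unfolding completion.AE_iff_null_sets negligible_iff_null_sets
    by (intro arg_cong2[where f="(\<in>)"]) auto
  finally show ?thesis .
qed

lemma conegligible_meets_interval:
  assumes "negligible ({0..1} - G)" "0 \<le> u" "u < v" "v \<le> (1::real)"
  obtains x where "x \<in> G" "u < x" "x < v"
proof -
  have "\<not> negligible {u<..<v}"
    using assms(3) open_not_negligible[of "{u<..<v}"] by auto
  then have "\<not> {u<..<v} \<subseteq> {0..1} - G"
    using assms(1) negligible_subset by blast
  with that assms show thesis by fastforce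
qed

text \<open>
  Applied to the branches of the map: the complement of the hull is closed under inverse branches, so
  there an identity that holds almost everywhere holds along all backward orbits.
\<close>
lemma negligible_invariant_hull:
  fixes N :: "real set"
  assumes "negligible N" "finite F" "\<And>\<phi> S. \<phi> \<in> F \<Longrightarrow> negligible S \<Longrightarrow> negligible (\<phi> ` S)"
  obtains B where "negligible B" "N \<subseteq> B" "\<And>\<phi> x. \<phi> \<in> F \<Longrightarrow> x \<in> B \<Longrightarrow> \<phi> x \<in> B"
proof -
  define S where "S n = ((\<lambda>S. \<Union>\<phi>\<in>F. \<phi> ` S) ^^ n) N" for n
  have S_Suc: "S (Suc n) = (\<Union>\<phi>\<in>F. \<phi> ` S n)" for n by (simp add: S_def)
  have "negligible (S n)" for n
  proof (induction n)
    case 0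
    then show ?case using assms(1) by (simp add: S_def)
  next
    case (Suc n)
    then show ?case unfolding S_Suc using assms(2,3) by (intro negligible_Union) auto
  qed
  then have "negligible (\<Union>n. S n)" by (rule negligible_Union_nat)
  moreover have "N \<subseteq> (\<Union>n. S n)" by (rule order_trans[OF _ UN_upper[of 0]]) (auto simp: S_def)
  moreover have "\<phi> x \<in> (\<Union>n. S n)" if "\<phi> \<in> F" "x \<in> (\<Union>n. S n)" for \<phi> x
    using that S_Suc by blast
  ultimately show thesis using that by blast
qed

lemma sorted_map_mono_on:
  "sorted xs \<Longrightarrow> (\<And>x y. x \<in> set xs \<Longrightarrow> y \<in> set xs \<Longrightarrow> x \<le> y \<Longrightarrow> f x \<le> f y) \<Longrightarrow> sorted (map f xs)"
  by (induction xs) auto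

lemma sorted_rev_map_antimono_on:
  "sorted xs \<Longrightarrow> (\<And>x y. x \<in> set xs \<Longrightarrow> y \<in> set xs \<Longrightarrow> x \<le> y \<Longrightarrow> f y \<le> f x) \<Longrightarrow> sorted (rev (map f xs))"
  by (induction xs) (auto simp: sorted_append)

section \<open>The map and its inverse branches\<close>

text \<open>The condition \<open>small\<close> says that \<open>W (1/2)\<close> lies in the domain of the third branch.\<close>
locale w_map =
  fixes s1 s2 r a :: real
  assumes s1_gt_1: "s1 > 1" and s2_gt_1: "s2 > 1" and conjugate: "1 / s1 + 1 / s2 = 1"
    and r_pos: "r > 0" and a_pos: "a > 0" and small: "2 * s2 * r * a < 1"
begin

definition b :: real where "b = 1 + 2 * r * a"
definition d :: real where "d = r * a"
text \<open>The turning value \<open>W (1/2) = 1/2 + r a\<close>.\<close>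
abbreviation p :: real where "p \<equiv> b / 2"

text \<open>The affine inverses of the four branches, extended to the whole line.\<close>
definition t1 :: "real \<Rightarrow> real" where "t1 x = (1 - x) / (2 * s2)"
definition t2 :: "real \<Rightarrow> real" where "t2 x = x / (s1 * b) + 1 / (2 * s2)"
definition t3 :: "real \<Rightarrow> real" where "t3 x = 1 / 2 + 1 / (2 * s2) - x / (s2 * b)"
definition t4 :: "real \<Rightarrow> real" where "t4 x = 1 - (1 - x) / (2 * s1)"

lemma d_pos: "0 < d" using r_pos a_pos by (simp add: d_def)

lemma b_eq: "b = 1 + 2 * d" by (simp add: b_def d_def)

lemma b_gt_1: "1 < b" using d_pos by (simp add: b_eq)

lemma p_eq: "p = 1 / 2 + d" by (simp add: b_eq)

lemma p_less: "p < 1 / 2 + 1 / (2 * s2)"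
  using small s2_gt_1 by (simp add: b_def field_simps)

lemma b_less_2: "b < 2"
proof -
  have "1 / (2 * s2) < 1 / 2" using s2_gt_1 by simp
  then show ?thesis using p_less by simp
qed

text \<open>The same point is written \<open>1/2 - 1 / (2 s1)\<close> in the map and \<open>1 / (2 s2)\<close> below.\<close>
lemma half_inverse_s1: "1 / (2 * s1) = 1 / 2 - 1 / (2 * s2)"
  using conjugate by (simp add: field_simps)

lemma s1_times_s2: "s1 * s2 = s1 + s2"
  using conjugate s1_gt_1 s2_gt_1 by (simp add: field_simps)

lemma slope_eq: "s1 + 2 * r * s1 * a = s1 * b" "s2 + 2 * r * s2 * a = s2 * b"
  by (auto simp: b_def algebra_simps)

lemma slopes_pos: "s1 * b > 0" "s2 * b > 0"
  using s1_gt_1 s2_gt_1 b_gt_1 by auto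

lemma inv_branches:
  "inv (W1 s2) = t1" "inv (W2 s1 r a) = t2" "inv (W3 s2 r a) = t3" "inv (W4 s1) = t4"
proof -
  have h: "1 / (2 * s1) = 1 / 2 - 1 / (2 * s2)" by (rule half_inverse_s1)
  have nz: "s1 \<noteq> 0" "s2 \<noteq> 0" "b \<noteq> 0" using s1_gt_1 s2_gt_1 b_gt_1 by auto
  show "inv (W1 s2) = t1"
    by (rule inv_equality) (use nz in \<open>auto simp: W1_def t1_def field_simps\<close>)
  have W2: "W2 s1 r a x = (s1 * b) * (x - 1 / (2 * s2))" for x
    unfolding W2_def slope_eq h by (simp add: algebra_simps)
  show "inv (W2 s1 r a) = t2"
    by (rule inv_equality) (use nz in \<open>simp_all add: W2 t2_def\<close>)
  show "inv (W3 s2 r a) = t3"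
    by (rule inv_equality) (use nz in \<open>simp_all add: W3_def slope_eq t3_def\<close>)
  show "inv (W4 s1) = t4"
    by (rule inv_equality) (use nz in \<open>auto simp: W4_def t4_def field_simps\<close>)
qed

lemma branch_inverse: "W1 s2 (t1 x) = x" "W2 s1 r a (t2 x) = x" "W3 s2 r a (t3 x) = x" "W4 s1 (t4 x) = x"
proof -
  have h: "1 / (2 * s1) = 1 / 2 - 1 / (2 * s2)" by (rule half_inverse_s1)
  have nz: "s1 \<noteq> 0" "s2 \<noteq> 0" "b \<noteq> 0" using s1_gt_1 s2_gt_1 b_gt_1 by auto
  show "W1 s2 (t1 x) = x" using nz by (auto simp: W1_def t1_def field_simps)
  have "t2 x - 1 / 2 + 1 / (2 * s1) = x / (s1 * b)" unfolding t2_def h by simp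
  then show "W2 s1 r a (t2 x) = x" using nz unfolding W2_def slope_eq by simp
  show "W3 s2 r a (t3 x) = x" using nz by (simp add: W3_def slope_eq t3_def)
  show "W4 s1 (t4 x) = x" using nz by (auto simp: W4_def t4_def field_simps)
qed

lemma FP_eq:
  "FP s1 s2 r a f x = f (t1 x) / (2 * s2) + f (t2 x) / (s1 * b) * indicator {0..p} x
     + f (t3 x) / (s2 * b) * indicator {0..p} x + f (t4 x) / (2 * s1)"
  unfolding FP_def inv_branches slope_eq I_set_def p_eq d_def by simp

lemma t1_bounds: "0 \<le> x \<Longrightarrow> x \<le> 1 \<Longrightarrow> 0 \<le> t1 x \<and> t1 x \<le> 1 / (2 * s2)"
  using s2_gt_1 unfolding t1_def by (auto simp: divide_simps)

lemma t2_bounds: "0 \<le> x \<Longrightarrow> x \<le> p \<Longrightarrow> 1 / (2 * s2) \<le> t2 x \<and> t2 x \<le> 1 / 2"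
proof -
  assume x: "0 \<le> x" "x \<le> p"
  have "x / (s1 * b) \<le> p / (s1 * b)" using x slopes_pos by (intro divide_right_mono) auto
  also have "p / (s1 * b) = 1 / (2 * s1)" using s1_gt_1 b_gt_1 by (simp add: field_simps)
  finally have "x / (s1 * b) \<le> 1 / (2 * s1)" .
  moreover have "0 \<le> x / (s1 * b)" using x slopes_pos by simp
  ultimately show ?thesis unfolding t2_def half_inverse_s1 by linarith
qed

lemma t2_less_half: "x < p \<Longrightarrow> t2 x < 1 / 2"
proof -
  assume x: "x < p"
  have "x / (s1 * b) < p / (s1 * b)" using x slopes_pos by (intro divide_strict_right_mono) auto
  also have "p / (s1 * b) = 1 / (2 * s1)" using s1_gt_1 b_gt_1 by (simp add: field_simps)
  finally show ?thesis unfolding t2_def half_inverse_s1 by linarith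
qed

lemma t3_bounds: "0 \<le> x \<Longrightarrow> x \<le> p \<Longrightarrow> 1 / 2 \<le> t3 x \<and> t3 x \<le> 1 / 2 + 1 / (2 * s2)"
proof -
  assume x: "0 \<le> x" "x \<le> p"
  have "x / (s2 * b) \<le> p / (s2 * b)" using x slopes_pos by (intro divide_right_mono) auto
  also have "p / (s2 * b) = 1 / (2 * s2)" using s2_gt_1 b_gt_1 by (simp add: field_simps)
  finally have "x / (s2 * b) \<le> 1 / (2 * s2)" .
  moreover have "0 \<le> x / (s2 * b)" using x slopes_pos by simp
  ultimately show ?thesis unfolding t3_def by linarith
qed

lemma t3_greater_half: "x < p \<Longrightarrow> 1 / 2 < t3 x"
proof -
  assume x: "x < p"
  have "x / (s2 * b) < p / (s2 * b)" using x slopes_pos by (intro divide_strict_right_mono) auto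
  also have "p / (s2 * b) = 1 / (2 * s2)" using s2_gt_1 b_gt_1 by (simp add: field_simps)
  finally show ?thesis unfolding t3_def by linarith
qed

lemma t4_bounds: "0 \<le> x \<Longrightarrow> x \<le> 1 \<Longrightarrow> 1 / 2 + 1 / (2 * s2) \<le> t4 x \<and> t4 x \<le> 1"
proof -
  assume x: "0 \<le> x" "x \<le> 1"
  have "(1 - x) / (2 * s1) \<le> 1 / (2 * s1)" using x s1_gt_1 by (intro divide_right_mono) auto
  then show ?thesis using x s1_gt_1 half_inverse_s1 by (simp add: t4_def)
qed

lemma t_mono:
  "x \<le> y \<Longrightarrow> t1 y \<le> t1 x" "x \<le> y \<Longrightarrow> t2 x \<le> t2 y" "x \<le> y \<Longrightarrow> t3 y \<le> t3 x" "x \<le> y \<Longrightarrow> t4 x \<le> t4 y"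
  using s1_gt_1 s2_gt_1 slopes_pos
  by (auto simp: t1_def t2_def t3_def t4_def intro!: divide_right_mono diff_left_mono)

section \<open>Simplicity of large eigenvalues\<close>

text \<open>
  A chain \<open>xs\<close> has four chains of preimages, one per branch; laid side by side (those of the two
  decreasing branches reversed) they form one chain in \<open>[0, 1]\<close>, so their variations add up to at most
  \<open>B\<close>, and each enters \<open>P g\<close> with a weight of at most \<open>\<theta>\<close>. Points to the right of \<open>p\<close> have no
  preimages in the two middle branches. They are given the substitutes \<open>y\<^sub>n\<close> and \<open>z\<^sub>n\<close>, close to
  \<open>1/2\<close>; the error of doing so is the jump at \<open>p\<close>, which tends to \<open>0\<close> by the assumption \<open>bal\<close>.
\<close>
lemma balanced_variation_contraction:
  fixes g :: "real \<Rightarrow> real"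
  assumes G: "G \<subseteq> {0..1}" "p \<notin> G" "\<And>x. x \<in> G \<Longrightarrow> t1 x \<in> G" "\<And>x. x \<in> G \<Longrightarrow> t4 x \<in> G"
      "\<And>x. x \<in> G \<Longrightarrow> x < p \<Longrightarrow> t2 x \<in> G" "\<And>x. x \<in> G \<Longrightarrow> x < p \<Longrightarrow> t3 x \<in> G"
    and FP: "\<And>x. x \<in> G \<Longrightarrow> FP s1 s2 r a g x = lam * g x"
    and y: "\<And>n. y n \<in> G" "\<And>n. y n < 1 / 2" "y \<longlonglongrightarrow> 1 / 2"
    and z: "\<And>n. z n \<in> G" "\<And>n. 1 / 2 < z n" "z \<longlonglongrightarrow> 1 / 2"
    and bal: "(\<lambda>n. g (y n) / (s1 * b) + g (z n) / (s2 * b)) \<longlonglongrightarrow> 0"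
    and theta: "1 / (s1 * b) \<le> \<theta>" "1 / (s2 * b) \<le> \<theta>" and lam: "lam > 0"
    and B: "\<And>xs. sorted xs \<Longrightarrow> set xs \<subseteq> G \<Longrightarrow> list_variation g xs \<le> B"
    and xs: "sorted xs" "set xs \<subseteq> G"
  shows "lam * list_variation g xs \<le> \<theta> * B"
proof (rule field_le_epsilon)
  fix e :: real assume "e > 0"
  define \<delta> where "\<delta> = e / (2 * real (length xs) + 1)"
  have \<delta>: "\<delta> > 0" "2 * \<delta> * real (length xs) \<le> e"
    using \<open>e > 0\<close> by (auto simp: \<delta>_def field_simps)
  \<comment> \<open>Choose \<open>n\<close> so large that the substitutes lie between all genuine preimages and \<open>1/2\<close>.\<close>
  have "\<forall>\<^sub>F n in sequentially. \<forall>x\<in>set xs. x < p \<longrightarrow> t2 x < y n \<and> z n < t3 x"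
  proof (intro eventually_ball_finite ballI finite_set)
    fix x
    show "\<forall>\<^sub>F n in sequentially. x < p \<longrightarrow> t2 x < y n \<and> z n < t3 x"
    proof (cases "x < p")
      case True
      show ?thesis
        using order_tendstoD(1)[OF y(3) t2_less_half[OF True]] order_tendstoD(2)[OF z(3) t3_greater_half[OF True]]
        by eventually_elim simp
    qed simp
  qed
  moreover have "\<forall>\<^sub>F n in sequentially. \<bar>g (y n) / (s1 * b) + g (z n) / (s2 * b)\<bar> < \<delta>"
    using order_tendstoD(2)[OF tendsto_rabs_zero[OF bal] \<delta>(1)] .
  moreover have "\<forall>\<^sub>F n in sequentially. 1 / (2 * s2) < y n"
    by (rule order_tendstoD(1)[OF y(3)]) (use s2_gt_1 in simp)
  moreover have "\<forall>\<^sub>F n in sequentially. z n < 1 / 2 + 1 / (2 * s2)"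
    by (rule order_tendstoD(2)[OF z(3)]) (use s2_gt_1 in simp)
  ultimately have "\<forall>\<^sub>F n in sequentially. (\<forall>x\<in>set xs. x < p \<longrightarrow> t2 x < y n \<and> z n < t3 x)
      \<and> \<bar>g (y n) / (s1 * b) + g (z n) / (s2 * b)\<bar> < \<delta> \<and> 1 / (2 * s2) < y n \<and> z n < 1 / 2 + 1 / (2 * s2)"
    by eventually_elim blast
  then obtain n where n: "\<And>x. x \<in> set xs \<Longrightarrow> x < p \<Longrightarrow> t2 x < y n \<and> z n < t3 x"
      "\<bar>g (y n) / (s1 * b) + g (z n) / (s2 * b)\<bar> < \<delta>" "1 / (2 * s2) < y n" "z n < 1 / 2 + 1 / (2 * s2)"
    unfolding eventually_sequentially by blast
  define T2 where "T2 x = (if x < p then t2 x else y n)" for x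
  define T3 where "T3 x = (if x < p then t3 x else z n)" for x
  define E where "E x = (if x < p then 0 else - (g (y n) / (s1 * b) + g (z n) / (s2 * b)))" for x
  have xs01: "0 \<le> x" "x \<le> 1" if "x \<in> set xs" for x
    using that xs(2) G(1) by (auto dest!: subsetD)
  define L where "L = rev (map t1 xs) @ map T2 xs @ rev (map T3 xs) @ map t4 xs"
  have bd1: "t1 x \<le> 1 / (2 * s2)" if "x \<in> set xs" for x using t1_bounds xs01 that by blast
  have bd2: "1 / (2 * s2) \<le> T2 x" "T2 x \<le> 1 / 2" if "x \<in> set xs" for x
    using t2_bounds[of x] xs01[OF that] n(3) y(2)[of n] by (auto simp: T2_def)
  have bd3: "1 / 2 \<le> T3 x" "T3 x \<le> 1 / 2 + 1 / (2 * s2)" if "x \<in> set xs" for x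
    using t3_bounds[of x] xs01[OF that] n(4) z(2)[of n] by (auto simp: T3_def)
  have bd4: "1 / 2 + 1 / (2 * s2) \<le> t4 x" if "x \<in> set xs" for x using t4_bounds xs01 that by blast
  have s1': "sorted (rev (map t1 xs))"
    by (rule sorted_rev_map_antimono_on[OF xs(1)]) (rule t_mono)
  have s2': "sorted (map T2 xs)"
    by (rule sorted_map_mono_on[OF xs(1)]) (use n(1) t_mono(2) in \<open>force simp: T2_def\<close>)
  have s3': "sorted (rev (map T3 xs))"
    by (rule sorted_rev_map_antimono_on[OF xs(1)]) (use n(1) t_mono(3) in \<open>force simp: T3_def\<close>)
  have s4': "sorted (map t4 xs)"
    by (rule sorted_map_mono_on[OF xs(1)]) (rule t_mono)
  have "sorted L"
    unfolding L_def sorted_append using s1' s2' s3' s4' bd1 bd2 bd3 bd4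
    by (auto simp del: sorted_map) (meson order_trans bd1 bd2 bd3 bd4 less_imp_le)+
  have "set L \<subseteq> G"
    using xs(2) G y(1) z(1) by (auto simp: L_def T2_def T3_def)
  \<comment> \<open>The outer branches are steeper than the middle ones because \<open>b < 2\<close>.\<close>
  have "1 / (2 * s2) \<le> 1 / (s2 * b)" "1 / (2 * s1) \<le> 1 / (s1 * b)"
    using s1_gt_1 s2_gt_1 b_gt_1 b_less_2 by (auto intro!: divide_left_mono)
  then have theta': "1 / (2 * s2) \<le> \<theta>" "1 / (2 * s1) \<le> \<theta>" using theta by auto
  have eq: "lam * g x = 1 / (2 * s2) * g (t1 x) + (1 / (s1 * b) * g (T2 x)
      + (1 / (s2 * b) * g (T3 x) + (1 / (2 * s1) * g (t4 x) + E x)))" if "x \<in> set xs" for x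
  proof -
    have "x \<in> G" using that xs(2) by blast
    then have "x \<noteq> p" using G(2) by blast
    show ?thesis
    proof (cases "x < p")
      case True
      then show ?thesis
        using xs01[OF that] FP[OF \<open>x \<in> G\<close>] unfolding FP_eq by (simp add: T2_def T3_def E_def)
    next
      case False
      then have "x > p" using \<open>x \<noteq> p\<close> by simp
      then show ?thesis
        using FP[OF \<open>x \<in> G\<close>] unfolding FP_eq by (simp add: T2_def T3_def E_def)
    qed
  qed
  have "lam * list_variation g xs = list_variation (\<lambda>x. lam * g x) xs"
    using lam by (simp add: list_variation_cmult)
  also have "\<dots> = list_variation (\<lambda>x. 1 / (2 * s2) * g (t1 x) + (1 / (s1 * b) * g (T2 x)
      + (1 / (s2 * b) * g (T3 x) + (1 / (2 * s1) * g (t4 x) + E x)))) xs"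
    using eq by (rule list_variation_cong)
  also have "\<dots> \<le> list_variation (\<lambda>x. 1 / (2 * s2) * g (t1 x)) xs + (list_variation (\<lambda>x. 1 / (s1 * b) * g (T2 x)) xs
      + (list_variation (\<lambda>x. 1 / (s2 * b) * g (T3 x)) xs
      + (list_variation (\<lambda>x. 1 / (2 * s1) * g (t4 x)) xs + list_variation E xs)))"
    by (intro order_trans[OF list_variation_add_le] add_left_mono order_refl)
  also have "\<dots> \<le> \<theta> * list_variation g (rev (map t1 xs)) + (\<theta> * list_variation g (map T2 xs)
      + (\<theta> * list_variation g (rev (map T3 xs)) + (\<theta> * list_variation g (map t4 xs) + e)))"
  proof (intro add_mono)
    have "list_variation E xs \<le> 2 * \<delta> * real (length xs)"
      using n(2) \<delta>(1) by (intro list_variation_le_sup) (auto simp: E_def)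
    then show "list_variation E xs \<le> e" using \<delta>(2) by simp
  qed (use s1_gt_1 s2_gt_1 slopes_pos theta theta' in
      \<open>auto simp: list_variation_cmult list_variation_rev list_variation_map
        simp del: times_divide_eq_left intro!: mult_right_mono list_variation_nonneg\<close>)
  also have "\<dots> = \<theta> * (list_variation g (rev (map t1 xs)) + (list_variation g (map T2 xs)
      + (list_variation g (rev (map T3 xs)) + list_variation g (map t4 xs)))) + e"
    by (simp add: algebra_simps)
  also have "\<dots> \<le> \<theta> * list_variation g L + e"
  proof -
    have "0 \<le> 1 / (s1 * b)" using slopes_pos by simp
    then have "0 \<le> \<theta>" using theta(1) by linarith
    have "list_variation g (rev (map t1 xs)) + (list_variation g (map T2 xs)
      + (list_variation g (rev (map T3 xs)) + list_variation g (map t4 xs))) \<le> list_variation g L"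
      unfolding L_def
      by (intro order_trans[OF _ list_variation_append_ge] add_left_mono order_refl)
    then show ?thesis using \<open>0 \<le> \<theta>\<close> by (intro add_right_mono mult_left_mono)
  qed
  also have "\<dots> \<le> \<theta> * B + e"
  proof -
    have "0 \<le> 1 / (s1 * b)" using slopes_pos by simp
    then have "0 \<le> \<theta>" using theta(1) by linarith
    then show ?thesis using B[OF \<open>sorted L\<close> \<open>set L \<subseteq> G\<close>] by (intro add_right_mono mult_left_mono)
  qed
  finally show "lam * list_variation g xs \<le> \<theta> * B + e" .
qed

lemma conegligible_backward_invariant_set:
  assumes "negligible N"
  obtains G where "G \<subseteq> {0..1}" "negligible ({0..1} - G)" "G \<inter> N = {}" "p \<notin> G"
      "\<And>x. x \<in> G \<Longrightarrow> t1 x \<in> G" "\<And>x. x \<in> G \<Longrightarrow> t4 x \<in> G"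
      "\<And>x. x \<in> G \<Longrightarrow> x < p \<Longrightarrow> t2 x \<in> G" "\<And>x. x \<in> G \<Longrightarrow> x < p \<Longrightarrow> t3 x \<in> G"
proof -
  obtain B where B: "negligible B" "insert p N \<subseteq> B"
    "\<And>\<phi> x. \<phi> \<in> {W1 s2, W2 s1 r a, W3 s2 r a, W4 s1} \<Longrightarrow> x \<in> B \<Longrightarrow> \<phi> x \<in> B"
  proof (rule negligible_invariant_hull)
    show "negligible (insert p N)" using assms by simp
    fix \<phi> and S :: "real set"
    assume "\<phi> \<in> {W1 s2, W2 s1 r a, W3 s2 r a, W4 s1}" "negligible S"
    moreover have "W1 s2 differentiable_on S" "W2 s1 r a differentiable_on S"
        "W3 s2 r a differentiable_on S" "W4 s1 differentiable_on S"
      unfolding W1_def W2_def W3_def W4_def by (auto intro!: derivative_intros)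
    ultimately show "negligible (\<phi> ` S)"
      by (intro negligible_differentiable_image_negligible) auto
  qed auto
  let ?G = "{0..1} - B"
  have "1 / (2 * s2) < 1 / 2" "0 < 1 / (2 * s2)" using s2_gt_1 by simp_all
  note h = this
  have notin: "t1 x \<notin> B" "t2 x \<notin> B" "t3 x \<notin> B" "t4 x \<notin> B" if "x \<notin> B" for x
    using that B(3) branch_inverse by (metis insertCI)+
  show thesis
  proof (rule that[of ?G])
    show "negligible ({0..1} - ?G)" using B(1) by (rule negligible_subset) auto
    show "t1 x \<in> ?G" if "x \<in> ?G" for x
    proof -
      have "0 \<le> t1 x" "t1 x \<le> 1 / (2 * s2)" using t1_bounds[of x] that by auto
      moreover from this(2) have "t1 x \<le> 1" using h by linarith
      ultimately show ?thesis using notin that by auto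
    qed
    show "t4 x \<in> ?G" if "x \<in> ?G" for x
    proof -
      have "1 / 2 + 1 / (2 * s2) \<le> t4 x" "t4 x \<le> 1" using t4_bounds[of x] that by auto
      moreover from this(1) have "0 \<le> t4 x" using h by linarith
      ultimately show ?thesis using notin that by auto
    qed
    show "t2 x \<in> ?G" if "x \<in> ?G" "x < p" for x
    proof -
      have "1 / (2 * s2) \<le> t2 x" "t2 x \<le> 1 / 2" using t2_bounds[of x] that by auto
      then have "0 \<le> t2 x" "t2 x \<le> 1" using h by linarith+
      then show ?thesis using notin that by auto
    qed
    show "t3 x \<in> ?G" if "x \<in> ?G" "x < p" for x
    proof -
      have "1 / 2 \<le> t3 x" "t3 x \<le> 1 / 2 + 1 / (2 * s2)" using t3_bounds[of x] that by auto
      then have "0 \<le> t3 x" "t3 x \<le> 1" using h by linarith+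
      then show ?thesis using notin that by auto
    qed
  qed (use B(2) in auto)
qed

lemma FP_diff: "FP s1 s2 r a (\<lambda>x. f x - k * g x) x = FP s1 s2 r a f x - k * FP s1 s2 r a g x"
  unfolding FP_eq by (simp add: algebra_simps diff_divide_distrib)

text \<open>
  One-sided limits of \<open>f\<close> at \<open>1/2\<close> are avoided: boundedness of \<open>f\<close> gives sequences approaching
  \<open>1/2\<close> from both sides along which the jump functional converges, and the multiple \<open>k\<close> of \<open>\<phi>\<close>
  is chosen to cancel its limit. The contraction estimate, iterated, then forces \<open>f - k \<phi>\<close> to be
  constant on a set of full measure, and the cancelled jump forces the constant to be \<open>0\<close>.
\<close>
lemma eigenfunction_unique:
  fixes f \<phi> :: "real \<Rightarrow> real"
  assumes f: "eigenfunction (FP s1 s2 r a) lam f" and \<phi>: "eigenfunction (FP s1 s2 r a) lam \<phi>"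
    and plateau: "u < 1 / 2" "1 / 2 < v" "\<And>x. u < x \<Longrightarrow> x < v \<Longrightarrow> \<phi> x = H" "H \<noteq> 0"
    and lam: "1 / (s1 * b) < lam" "1 / (s2 * b) < lam"
  shows "\<exists>k. ae_eq f (\<lambda>x. k * \<phi> x)"
proof -
  define N where "N = {x \<in> {0..1}. FP s1 s2 r a f x \<noteq> lam * f x} \<union> {x \<in> {0..1}. FP s1 s2 r a \<phi> x \<noteq> lam * \<phi> x}"
  have "negligible N"
    using f \<phi> unfolding eigenfunction_def ae_eq_iff_negligible N_def by auto
  then obtain G where G: "G \<subseteq> {0..1}" "negligible ({0..1} - G)" "G \<inter> N = {}" "p \<notin> G"
      "\<And>x. x \<in> G \<Longrightarrow> t1 x \<in> G" "\<And>x. x \<in> G \<Longrightarrow> t4 x \<in> G"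
      "\<And>x. x \<in> G \<Longrightarrow> x < p \<Longrightarrow> t2 x \<in> G" "\<And>x. x \<in> G \<Longrightarrow> x < p \<Longrightarrow> t3 x \<in> G"
    by (rule conegligible_backward_invariant_set) blast
  have "\<exists>y. y \<in> G \<and> 1 / 2 - 1 / real (n + 2) < y \<and> y < 1 / 2" for n
    using conegligible_meets_interval[OF G(2), of "1 / 2 - 1 / real (n + 2)" "1 / 2"]
    by (force simp: field_simps)
  then obtain y where y: "\<And>n. y n \<in> G" "\<And>n. 1 / 2 - 1 / real (n + 2) < y n" "\<And>n. y n < 1 / 2"
    by metis
  have "\<exists>z. z \<in> G \<and> 1 / 2 < z \<and> z < 1 / 2 + 1 / real (n + 2)" for n
    using conegligible_meets_interval[OF G(2), of "1 / 2" "1 / 2 + 1 / real (n + 2)"]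
    by (force simp: field_simps)
  then obtain z where z: "\<And>n. z n \<in> G" "\<And>n. 1 / 2 < z n" "\<And>n. z n < 1 / 2 + 1 / real (n + 2)"
    by metis
  have lim0: "(\<lambda>n. 1 / real (n + 2)) \<longlonglongrightarrow> 0" by real_asymp
  have ylim: "y \<longlonglongrightarrow> 1 / 2"
  proof (rule tendsto_sandwich)
    show "(\<lambda>n. 1 / 2 - 1 / real (n + 2)) \<longlonglongrightarrow> 1 / 2" using tendsto_diff[OF tendsto_const lim0, of "1 / 2"] by simp
  qed (use y in \<open>auto intro!: always_eventually less_imp_le simp del: of_nat_add\<close>)
  have zlim: "z \<longlonglongrightarrow> 1 / 2"
  proof (rule tendsto_sandwich[of "\<lambda>_. 1 / 2" z _ "\<lambda>n. 1 / 2 + 1 / real (n + 2)"])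
    show "(\<lambda>n. 1 / 2 + 1 / real (n + 2)) \<longlonglongrightarrow> 1 / 2" using tendsto_add[OF tendsto_const lim0, of "1 / 2"] by simp
    show "\<forall>\<^sub>F n in sequentially. 1 / 2 \<le> z n" "\<forall>\<^sub>F n in sequentially. z n \<le> 1 / 2 + 1 / real (n + 2)"
      using z by (auto intro!: always_eventually less_imp_le simp del: of_nat_add)
  qed simp
  have bv: "bounded_variation_on 0 1 f" "bounded_variation_on 0 1 \<phi>"
    using f \<phi> unfolding eigenfunction_def by auto
  obtain M where M: "\<And>x. x \<in> {0..1} \<Longrightarrow> \<bar>f x\<bar> \<le> M"
    using bounded_variation_on_imp_bounded[OF bv(1)] by auto
  define e where "e n = f (y n) / (s1 * b) + f (z n) / (s2 * b)" for n
  have "bounded (range e)"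
    unfolding bounded_iff
  proof (intro exI ballI)
    fix w assume "w \<in> range e"
    then obtain n where n: "w = e n" by blast
    have "\<bar>f (y n)\<bar> / (s1 * b) \<le> M / (s1 * b)" "\<bar>f (z n)\<bar> / (s2 * b) \<le> M / (s2 * b)"
      using M y(1)[of n] z(1)[of n] G(1) slopes_pos by (auto intro!: divide_right_mono)
    moreover have "\<bar>e n\<bar> \<le> \<bar>f (y n) / (s1 * b)\<bar> + \<bar>f (z n) / (s2 * b)\<bar>" unfolding e_def by (rule abs_triangle_ineq)
    moreover have "\<bar>f (y n) / (s1 * b)\<bar> = \<bar>f (y n)\<bar> / (s1 * b)" "\<bar>f (z n) / (s2 * b)\<bar> = \<bar>f (z n)\<bar> / (s2 * b)"
      using slopes_pos by (simp_all add: abs_divide del: abs_mult)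
    ultimately show "norm w \<le> M / (s1 * b) + M / (s2 * b)" unfolding n real_norm_def by linarith
  qed
  then obtain l \<sigma> where \<sigma>: "strict_mono \<sigma>" "(e \<circ> \<sigma>) \<longlonglongrightarrow> l"
    using bounded_imp_convergent_subsequence by metis
  \<comment> \<open>The jump functional of \<open>\<phi>\<close> is \<open>H / (s1 * b) + H / (s2 * b) = H / b\<close>.\<close>
  define k where "k = l * b / H"
  define g where "g x = f x - k * \<phi> x" for x
  define y' where "y' = y \<circ> \<sigma>"
  define z' where "z' = z \<circ> \<sigma>"
  have y': "\<And>n. y' n \<in> G" "\<And>n. y' n < 1 / 2" "y' \<longlonglongrightarrow> 1 / 2"
    using y LIMSEQ_subseq_LIMSEQ[OF ylim \<sigma>(1)] by (auto simp: y'_def)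
  have z': "\<And>n. z' n \<in> G" "\<And>n. 1 / 2 < z' n" "z' \<longlonglongrightarrow> 1 / 2"
    using z LIMSEQ_subseq_LIMSEQ[OF zlim \<sigma>(1)] by (auto simp: z'_def)
  have sum_inv: "1 / (s1 * b) + 1 / (s2 * b) = 1 / b"
    using conjugate b_gt_1 by (simp add: field_simps)
  have bal: "(\<lambda>n. g (y' n) / (s1 * b) + g (z' n) / (s2 * b)) \<longlonglongrightarrow> 0"
  proof -
    have ev: "\<forall>\<^sub>F n in sequentially. g (y' n) / (s1 * b) + g (z' n) / (s2 * b) = (e \<circ> \<sigma>) n - l"
      using order_tendstoD(1)[OF y'(3) plateau(1)] order_tendstoD(2)[OF z'(3) plateau(2)]
    proof eventually_elim
      case (elim n)
      then have "\<phi> (y' n) = H" "\<phi> (z' n) = H"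
        using plateau(1-3) y'(2)[of n] z'(2)[of n] by auto
      then have "g (y' n) / (s1 * b) + g (z' n) / (s2 * b)
          = (e \<circ> \<sigma>) n - k * H * (1 / (s1 * b) + 1 / (s2 * b))"
        by (simp add: g_def e_def y'_def z'_def diff_divide_distrib distrib_left)
      also have "k * H * (1 / (s1 * b) + 1 / (s2 * b)) = l"
        unfolding sum_inv using plateau(4) b_gt_1 by (simp add: k_def)
      finally show ?case .
    qed
    have "(\<lambda>n. (e \<circ> \<sigma>) n - l) \<longlonglongrightarrow> 0" using \<sigma>(2) by (simp add: LIM_zero o_def)
    then show ?thesis using ev by (simp add: tendsto_cong)
  qed
  have FPg: "FP s1 s2 r a g x = lam * g x" if "x \<in> G" for x
  proof -
    have "x \<in> {0..1}" "x \<notin> N" using that G(1,3) by auto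
    then show ?thesis unfolding g_def FP_diff by (simp add: N_def algebra_simps)
  qed
  have "bounded_variation_on 0 1 g"
    using bounded_variation_on_add[OF bv(1) bounded_variation_on_cmult[OF bv(2), of "- k"]]
    by (simp add: g_def[abs_def])
  then obtain B where B: "\<And>xs. sorted xs \<Longrightarrow> set xs \<subseteq> {0..1} \<Longrightarrow> list_variation g xs \<le> B"
    by (rule bounded_variation_on_imp_list_bound) blast
  define \<theta> where "\<theta> = max (1 / (s1 * b)) (1 / (s2 * b))"
  have theta: "1 / (s1 * b) \<le> \<theta>" "1 / (s2 * b) \<le> \<theta>" "\<theta> < lam" using lam by (auto simp: \<theta>_def)
  have "0 < 1 / (s1 * b)" using slopes_pos by simp
  then have theta0: "0 \<le> \<theta>" "0 < lam" using theta lam by linarith+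
  have decay: "list_variation g xs \<le> (\<theta> / lam) ^ n * B" if "sorted xs" "set xs \<subseteq> G" for n xs
    using that
  proof (induction n arbitrary: xs)
    case 0
    then show ?case using B[of xs] G(1) by auto
  next
    case (Suc n)
    have "lam * list_variation g xs \<le> \<theta> * ((\<theta> / lam) ^ n * B)"
      by (rule balanced_variation_contraction[OF G(1) G(4-8) FPg y' z' bal theta(1,2) theta0(2) Suc.IH Suc.prems])
    then show ?case using theta0(2) by (simp add: field_simps)
  qed
  have "(\<lambda>n. (\<theta> / lam) ^ n) \<longlonglongrightarrow> 0"
    by (rule LIMSEQ_power_zero) (use theta theta0 in auto)
  then have lim: "(\<lambda>n. (\<theta> / lam) ^ n * B) \<longlonglongrightarrow> 0" by (rule tendsto_mult_left_zero)
  have "list_variation g xs \<le> 0" if "sorted xs" "set xs \<subseteq> G" for xs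
    by (rule LIMSEQ_le_const[OF lim]) (use decay[OF that] in auto)
  then have const: "g x = g x'" if "x \<in> G" "x' \<in> G" for x x'
    using that by (cases "x \<le> x'") (force dest: spec[of _ "[x, x']"] spec[of _ "[x', x]"])+
  have zero: "g x = 0" if "x \<in> G" for x
  proof -
    have "g (y' n) = g x" "g (z' n) = g x" for n using const that y'(1) z'(1) by blast+
    then have "(\<lambda>n. g x / (s1 * b) + g x / (s2 * b)) \<longlonglongrightarrow> 0" using bal by simp
    then have "g x / (s1 * b) + g x / (s2 * b) = 0" by (simp add: LIMSEQ_const_iff)
    moreover have "g x / (s1 * b) + g x / (s2 * b) = g x * (1 / (s1 * b) + 1 / (s2 * b))"
      by (simp add: distrib_left)
    ultimately show ?thesis using sum_inv b_gt_1 by simp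
  qed
  have "{x \<in> {0..1}. f x \<noteq> k * \<phi> x} \<subseteq> {0..1} - G"
    using zero by (auto simp: g_def)
  then have "ae_eq f (\<lambda>x. k * \<phi> x)"
    unfolding ae_eq_iff_negligible using G(2) negligible_subset by blast
  then show ?thesis ..
qed

end

section \<open>The orbit of the turning value\<close>
locale markov_w_map = w_map +
  fixes m :: nat
  assumes m_pos: "m \<ge> 1" and markov: "(s1 * b) ^ m * (4 * r\<^sup>2 * s2\<^sup>2 * a\<^sup>2) = 1"
begin

abbreviation w :: "nat \<Rightarrow> real" where "w i \<equiv> (W s1 s2 r a ^^ i) p"

text \<open>The fixed point of the second branch.\<close>
definition fixed_point :: real where "fixed_point = b / (2 * (1 + 2 * s2 * d))"

lemma fixed_point_eq: "s1 * b * (fixed_point - 1 / (2 * s2)) = fixed_point"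
proof -
  define D where "D = 1 + 2 * s2 * d"
  have D: "D > 0" using s2_gt_1 d_pos by (simp add: D_def add_pos_pos)
  have "s1 * b * s2 - s1 * D = (s1 * s2) * b - s1 - 2 * (s1 * s2) * d"
    by (simp add: D_def algebra_simps)
  also have "\<dots> = s2"
    unfolding s1_times_s2 by (simp add: b_eq algebra_simps)
  finally have *: "s1 * b * s2 - s1 * D = s2" .
  have "s1 * b * (b / (2 * D) - 1 / (2 * s2)) = b * (s1 * b * s2 - s1 * D) / (2 * D * s2)"
    using D s2_gt_1 by (simp add: field_simps)
  also have "\<dots> = b / (2 * D)" unfolding * using s2_gt_1 by simp
  finally show ?thesis unfolding fixed_point_def D_def .
qed

lemma fixed_point_less_half: "fixed_point < 1 / 2"
proof -
  have "b < 1 + 2 * s2 * d" using s2_gt_1 d_pos by (simp add: b_eq)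
  moreover have "0 < 1 + 2 * s2 * d" using s2_gt_1 d_pos by (simp add: add_pos_pos)
  ultimately show ?thesis unfolding fixed_point_def by (simp add: field_simps)
qed

lemma middle_slope_gt_1: "1 < s1 * b" using s1_gt_1 b_gt_1 by (simp add: less_1_mult)

lemma fixed_point_pos: "0 < fixed_point"
  using b_gt_1 s2_gt_1 d_pos by (auto simp: fixed_point_def intro!: divide_pos_pos add_pos_pos)

lemma W_p: "W s1 s2 r a p = p - s2 * b * d"
proof -
  have "0 < 1 / (2 * s1)" using s1_gt_1 by simp
  then have "\<not> p < 1 / 2 - 1 / (2 * s1)" "\<not> p < 1 / 2"
    using d_pos unfolding p_eq by linarith+
  then have "W s1 s2 r a p = W3 s2 r a p" using p_less unfolding W_def by simp
  also have "\<dots> = p - s2 * b * d"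
  proof -
    have "1 / 2 + 1 / (2 * s2) - p = 1 / (2 * s2) - d" unfolding p_eq by simp
    then have "W3 s2 r a p = s2 * b * (1 / (2 * s2) - d)" unfolding W3_def slope_eq by (simp only:)
    also have "\<dots> = p - s2 * b * d" using s2_gt_1 by (simp add: right_diff_distrib)
    finally show ?thesis .
  qed
  finally show ?thesis .
qed

lemma expansion_power: "(s1 * b) ^ m = 1 / (2 * s2 * d)\<^sup>2"
proof -
  have "(2 * s2 * d)\<^sup>2 = 4 * r\<^sup>2 * s2\<^sup>2 * a\<^sup>2" by (simp add: d_def power_mult_distrib)
  then have "(s1 * b) ^ m * (2 * s2 * d)\<^sup>2 = 1" using markov by simp
  moreover have "(2 * s2 * d)\<^sup>2 \<noteq> 0" using s2_gt_1 d_pos by simp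
  ultimately show ?thesis by (metis nonzero_eq_divide_eq)
qed

text \<open>
  The deviation of \<open>W p\<close> from the fixed point is the fixed point times \<open>(2 s2 d)\<^sup>2\<close>, which the Markov
  condition turns into a power of the slope.
\<close>
lemma W_p_fixed_point: "W s1 s2 r a p = fixed_point - fixed_point / (s1 * b) ^ m"
proof -
  have D: "1 + 2 * s2 * d > 0" using s2_gt_1 d_pos by (simp add: add_pos_pos)
  have 1: "fixed_point / (s1 * b) ^ m = fixed_point * (2 * s2 * d)\<^sup>2"
    unfolding expansion_power by simp
  have "fixed_point - fixed_point * (2 * s2 * d)\<^sup>2 = fixed_point * (1 + 2 * s2 * d) * (1 - 2 * s2 * d)"
    by (simp add: power2_eq_square algebra_simps)
  also have "fixed_point * (1 + 2 * s2 * d) = p"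
    using D unfolding fixed_point_def by (metis less_irrefl mult.commute nonzero_mult_divide_mult_cancel_left times_divide_eq_left)
  finally show ?thesis unfolding 1 W_p by (simp add: algebra_simps)
qed

lemma W_middle:
  assumes "1 / (2 * s2) \<le> x" "x < 1 / 2"
  shows "W s1 s2 r a x = s1 * b * (x - 1 / (2 * s2))"
proof -
  have "W s1 s2 r a x = W2 s1 r a x" using assms half_inverse_s1 unfolding W_def by auto
  then show ?thesis unfolding W2_def slope_eq half_inverse_s1 by (simp add: algebra_simps)
qed

text \<open>
  As long as the orbit stays in the second branch, its distance to the fixed point is multiplied by
  \<open>s1 b\<close>. By \<open>fixed_point_eq\<close> the left end of that branch has distance \<open>fixed_point / (s1 b)\<close>, which is
  reached at time \<open>m\<close>.
\<close>
lemma orbit: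
  assumes "1 \<le> i" "i \<le> m"
  shows "w i = fixed_point - fixed_point / (s1 * b) ^ (m + 1 - i)"
    and "1 / (2 * s2) \<le> w i" and "w i < 1 / 2"
proof -
  let ?v = "\<lambda>i. fixed_point - fixed_point / (s1 * b) ^ (m + 1 - i)"
  have v: "1 / (2 * s2) \<le> ?v i" "?v i < 1 / 2" if "i \<le> m" for i
  proof -
    have "(s1 * b) ^ 1 \<le> (s1 * b) ^ (m + 1 - i)"
      using that middle_slope_gt_1 by (intro power_increasing) auto
    then have "fixed_point / (s1 * b) ^ (m + 1 - i) \<le> fixed_point / (s1 * b)"
      using fixed_point_pos middle_slope_gt_1 by (intro divide_left_mono) auto
    moreover have "fixed_point - 1 / (2 * s2) = fixed_point / (s1 * b)"
      using fixed_point_eq slopes_pos by (metis less_irrefl nonzero_mult_div_cancel_left)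
    ultimately show "1 / (2 * s2) \<le> ?v i" by linarith
    have "0 < fixed_point / (s1 * b) ^ (m + 1 - i)" using fixed_point_pos middle_slope_gt_1 by simp
    then show "?v i < 1 / 2" using fixed_point_less_half by linarith
  qed
  show *: "w i = ?v i"
    using assms
  proof (induction i rule: dec_induct)
    case base
    then show ?case using W_p_fixed_point by simp
  next
    case (step n)
    then have n: "w n = ?v n" by simp
    have "1 / (2 * s2) \<le> w n" "w n < 1 / 2" using v[of n] step.prems unfolding n by auto
    then have "w (Suc n) = s1 * b * (w n - 1 / (2 * s2))" using W_middle by simp
    also have "\<dots> = s1 * b * (?v n - 1 / (2 * s2))" unfolding n ..
    also have "\<dots> = fixed_point - s1 * b * (fixed_point / (s1 * b) ^ (m + 1 - n))"
      using fixed_point_eq by (simp add: right_diff_distrib)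
    also have "m + 1 - n = Suc (m + 1 - Suc n)" using step.prems by simp
    also have "s1 * b * (fixed_point / (s1 * b) ^ Suc (m + 1 - Suc n)) = fixed_point / (s1 * b) ^ (m + 1 - Suc n)"
      using s1_gt_1 b_gt_1 by simp
    finally show ?case .
  qed
  show "1 / (2 * s2) \<le> w i" "w i < 1 / 2" unfolding * using v[OF assms(2)] .
qed

lemma orbit_Suc:
  assumes "1 \<le> i" "i < m"
  shows "w (Suc i) = s1 * b * (w i - 1 / (2 * s2))"
  using W_middle[of "w i"] orbit[of i] assms by simp

lemma orbit_last: "w m = 1 / (2 * s2)"
proof -
  have "fixed_point - 1 / (2 * s2) = fixed_point / (s1 * b)"
    using fixed_point_eq slopes_pos by (metis less_irrefl nonzero_mult_div_cancel_left)
  then show ?thesis using orbit(1)[of m] m_pos by simp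
qed

lemma orbit_le_first: "1 \<le> i \<Longrightarrow> i \<le> m \<Longrightarrow> w i \<le> w 1"
proof -
  assume i: "1 \<le> i" "i \<le> m"
  have "(s1 * b) ^ (m + 1 - i) \<le> (s1 * b) ^ (m + 1 - 1)"
    using i middle_slope_gt_1 by (intro power_increasing) auto
  then have "fixed_point / (s1 * b) ^ (m + 1 - 1) \<le> fixed_point / (s1 * b) ^ (m + 1 - i)"
    using fixed_point_pos middle_slope_gt_1 by (intro divide_left_mono) auto
  then show ?thesis using orbit(1)[OF i] orbit(1)[of 1] m_pos by simp
qed

lemma I_set_eq: "I_set s1 s2 r a 0 = {0..p}" "1 \<le> j \<Longrightarrow> I_set s1 s2 r a j = {w j..p}"
  unfolding I_set_def p_eq d_def by auto

text \<open>
  The next two lemmas say how the intervals are mapped: the second branch sends the part of \<open>I\<^sub>i\<close> in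
  its domain to \<open>I\<close> with index \<open>i + 1\<close>, and the third branch sends \<open>[1/2, p]\<close>, which lies in every
  \<open>I\<^sub>i\<close>, to \<open>I\<^sub>1\<close>.
\<close>
lemma t2_orbit_iff: "1 \<le> i \<Longrightarrow> i < m \<Longrightarrow> w i \<le> t2 x \<longleftrightarrow> w (Suc i) \<le> x"
proof -
  assume i: "1 \<le> i" "i < m"
  have "w i \<le> t2 x \<longleftrightarrow> w i - 1 / (2 * s2) \<le> x / (s1 * b)" unfolding t2_def by auto
  also have "\<dots> \<longleftrightarrow> (w i - 1 / (2 * s2)) * (s1 * b) \<le> x"
    using slopes_pos by (simp add: pos_le_divide_eq)
  also have "(w i - 1 / (2 * s2)) * (s1 * b) = w (Suc i)"
    using orbit_Suc[OF i] by (simp only: mult.commute)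
  finally show ?thesis .
qed

lemma t3_le_p_iff: "t3 x \<le> p \<longleftrightarrow> w 1 \<le> x"
proof -
  have "t3 x \<le> p \<longleftrightarrow> 1 / (2 * s2) - d \<le> x / (s2 * b)" unfolding t3_def p_eq by auto
  also have "\<dots> \<longleftrightarrow> (1 / (2 * s2) - d) * (s2 * b) \<le> x"
    using slopes_pos by (simp add: pos_le_divide_eq)
  also have "(1 / (2 * s2) - d) * (s2 * b) = w 1"
    using W_p s2_gt_1 by (simp add: algebra_simps)
  finally show ?thesis .
qed

end

section \<open>The step eigenfunction\<close>

text \<open>
  The assumption \<open>secular\<close> is the equation that fixes \<open>\<lambda>\<close>; the two inequalities keep the
  denominators in \<open>\<alpha>\<^sub>0\<close> and \<open>c\<close> positive.
\<close>
locale markov_w_eigenvalue = markov_w_map +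
  fixes lam :: real
  assumes lam_lower: "1 < lam * s1 * b" and lam_half: "1 / 2 < lam"
    and secular: "c_coeff s1 s2 r a m lam =
         lam * b * alpha0 s1 s2 r a m lam - alpha0 s1 s2 r a m lam / s1 - 1 / s1"
begin

abbreviation A :: "nat \<Rightarrow> real" where "A \<equiv> alpha s1 r a m lam"
abbreviation A0 :: real where "A0 \<equiv> alpha0 s1 s2 r a m lam"
abbreviation C :: real where "C \<equiv> c_coeff s1 s2 r a m lam"
abbreviation hm :: "real \<Rightarrow> real" where "hm \<equiv> h s1 s2 r a m lam"
definition q :: real where "q = lam * s1 * b"

lemma q_gt_1: "1 < q" using lam_lower by (simp add: q_def)

lemma A_eq: "A j = q ^ (m - j)"
  unfolding alpha_def q_def b_def by (simp add: power_mult_distrib)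

lemma A_Suc: "j < m \<Longrightarrow> A j = q * A (Suc j)"
  unfolding A_eq by (metis Suc_diff_Suc power_Suc)

lemma A_m: "A m = 1" unfolding A_eq by simp

lemma sum_A: "(\<Sum>j=1..m. A j) = (q ^ m - 1) / (q - 1)"
proof -
  have "(\<Sum>j=1..m. A j) = (\<Sum>i<m. q ^ i)"
    unfolding A_eq
    by (rule sum.reindex_bij_witness[of _ "\<lambda>i. m - i" "\<lambda>j. m - j"]) auto
  also have "\<dots> = (q ^ m - 1) / (q - 1)" using lam_lower by (simp add: q_def geometric_sum)
  finally show ?thesis .
qed

text \<open>
  The coefficient of \<open>\<chi>\<close> of \<open>I\<^sub>1\<close> in the eigenvalue equation: every \<open>I\<^sub>j\<close> contains \<open>[1/2, p]\<close>, so
  each contributes its full coefficient through the third branch. The definition of \<open>\<alpha>\<^sub>0\<close> is this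
  equation solved for \<open>\<alpha>\<^sub>0\<close>.
\<close>
lemma total_mass: "A0 + (\<Sum>j=1..m. A j) = lam * s2 * b * A 1"
proof -
  have q1: "q - 1 \<noteq> 0" using lam_lower by (simp add: q_def)
  have qm: "q ^ m = q * A 1" using A_eq[of 1] m_pos by (cases m) auto
  define X where "X = lam ^ m * s1 ^ (m - 1) * b ^ m"
  have X: "X * s1 = q * A 1"
    unfolding qm[symmetric] using m_pos unfolding X_def q_def power_mult_distrib by (cases m) auto
  have "A0 = (X * (lam * s1 * s2 * b - s1 * s2) + 1) / (q - 1)"
    unfolding alpha0_def X_def q_def b_def ..
  then have "A0 * (q - 1) = X * (lam * s1 * s2 * b - s1 * s2) + 1"
    using q1 by (metis nonzero_eq_divide_eq)
  also have "\<dots> = X * s1 * (lam * s2 * b - s2) + 1" by (simp add: algebra_simps)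
  also have "\<dots> = q * A 1 * (lam * s2 * b - s2) + 1" unfolding X ..
  finally have "A0 * (q - 1) + (q * A 1 - 1) = q * A 1 * (lam * s2 * b) - q * A 1 * (s2 - 1)"
    by (simp add: algebra_simps)
  also have "q * A 1 * (s2 - 1) = lam * s2 * b * A 1"
  proof -
    have "s1 * (s2 - 1) = s2" using s1_times_s2 by (simp add: algebra_simps)
    then have "lam * b * A 1 * (s1 * (s2 - 1)) = lam * b * A 1 * s2" by simp
    then show ?thesis by (simp add: q_def mult_ac)
  qed
  finally have "A0 * (q - 1) + (q * A 1 - 1) = lam * s2 * b * A 1 * (q - 1)"
    by (simp add: algebra_simps)
  then have "A0 + (q * A 1 - 1) / (q - 1) = lam * s2 * b * A 1"
    using q1 by (simp add: field_simps)
  then show ?thesis unfolding sum_A qm .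
qed

text \<open>The constant coefficient in the eigenvalue equation.\<close>
lemma C_eq: "C * (2 * lam - 1) = A0 / s2"
  using lam_half s2_gt_1 unfolding c_coeff_def by (simp add: field_simps)

lemma hm_eq: "hm x = C + A0 * indicator {0..p} x + (\<Sum>j=1..m. A j * indicator {w j..p} x)"
  unfolding h_def I_set_eq(1) by (intro arg_cong2[where f="(+)"] refl sum.cong) (simp add: I_set_eq)

lemma hm_plateau: "w 1 < x \<Longrightarrow> x < p \<Longrightarrow> hm x = C + lam * s2 * b * A 1"
proof -
  assume x: "w 1 < x" "x < p"
  have "0 < 1 / (2 * s2)" using s2_gt_1 by simp
  then have "0 \<le> x" using x orbit(2)[of 1] m_pos by linarith
  have "(\<Sum>j=1..m. A j * indicator {w j..p} x) = (\<Sum>j=1..m. A j)"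
    using x orbit_le_first by (intro sum.cong) (force simp: indicator_def)+
  then show ?thesis unfolding hm_eq total_mass[symmetric] using x \<open>0 \<le> x\<close> by simp
qed

text \<open>
  The jump of \<open>P h\<^sub>m = \<lambda> h\<^sub>m\<close> at \<open>p\<close>, read in two ways: it is \<open>\<lambda>\<close> times the sum of all \<open>\<alpha>\<^sub>j\<close>, and
  it is created by the middle branches from the value of \<open>h\<^sub>m\<close> at \<open>1/2\<close>. In particular that value
  is not \<open>0\<close>.
\<close>
lemma plateau_height: "C + lam * s2 * b * A 1 = lam * b * (lam * s2 * b * A 1)"
proof -
  define \<Sigma> where "\<Sigma> = (\<Sum>j=1..m. A j)"
  have qm: "q ^ m = q * A 1" using A_eq[of 1] m_pos by (cases m) auto
  have "\<Sigma> * (q - 1) = q * A 1 - 1"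
    using q_gt_1 unfolding \<Sigma>_def sum_A qm by simp
  then have "s1 * (lam * b * \<Sigma>) = s1 * (lam * b * A 1) + \<Sigma> - 1"
    by (simp add: q_def algebra_simps)
  then have "s1 * (lam * b * \<Sigma>) / s1 = (s1 * (lam * b * A 1) + \<Sigma> - 1) / s1" by simp
  then have 1: "lam * b * \<Sigma> = lam * b * A 1 + \<Sigma> / s1 - 1 / s1"
    using s1_gt_1 by (simp add: add_divide_distrib diff_divide_distrib)
  have "lam * b * A0 = C + A0 / s1 + 1 / s1" using secular by simp
  then have "lam * b * (A0 + \<Sigma>) = C + (A0 + \<Sigma>) / s1 + lam * b * A 1"
    using 1 by (simp add: distrib_left add_divide_distrib)
  also have "(A0 + \<Sigma>) / s1 = (A0 + \<Sigma>) - (A0 + \<Sigma>) / s2"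
  proof -
    have "1 / s1 = 1 - 1 / s2" using conjugate by simp
    then have "(A0 + \<Sigma>) * (1 / s1) = (A0 + \<Sigma>) * (1 - 1 / s2)" by simp
    then show ?thesis by (simp add: right_diff_distrib)
  qed
  also have "(A0 + \<Sigma>) / s2 = lam * b * A 1"
    using s2_gt_1 unfolding \<Sigma>_def total_mass by simp
  finally show ?thesis unfolding \<Sigma>_def total_mass by simp
qed

text \<open>
  To the right of \<open>p\<close> only the outer branches contribute, and the equation reduces to \<open>C_eq\<close>. To the
  left of \<open>p\<close> the second branch shifts the index of \<open>I\<^sub>j\<close> by one (with \<open>I\<^sub>m\<close> covering the whole
  branch) and the third one produces \<open>I\<^sub>1\<close>.
\<close>
lemma FP_hm:
  assumes "0 < x" "x < 1" "x \<noteq> p"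
  shows "FP s1 s2 r a hm x = lam * hm x"
proof -
  define M where "M = A0 + (\<Sum>j=1..m. A j)"
  have inv_s2: "0 < 1 / (2 * s2)" "1 / (2 * s2) < 1 / 2" using s2_gt_1 by simp_all
  have lamC: "lam * C = C / 2 + A0 / (2 * s2)"
    using C_eq s2_gt_1 by (simp add: field_simps)
  have split_C: "C / (2 * s2) + C / (2 * s1) = C / 2"
  proof -
    have "C / (2 * s2) + C / (2 * s1) = C / 2 * (1 / s1 + 1 / s2)" by (simp add: distrib_left)
    then show ?thesis unfolding conjugate by simp
  qed
  have "t1 x < 1 / (2 * s2)" "0 \<le> t1 x"
    using assms s2_gt_1 by (auto simp: t1_def divide_strict_right_mono)
  then have "t1 x < w j" if "1 \<le> j" "j \<le> m" for j using orbit(2)[OF that] by linarith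
  then have "(\<Sum>j=1..m. A j * indicator {w j..p} (t1 x)) = 0"
    by (intro sum.neutral) (force simp: indicator_def)
  moreover have "t1 x \<le> p" using \<open>t1 x < 1 / (2 * s2)\<close> inv_s2 b_gt_1 by linarith
  ultimately have h1: "hm (t1 x) = C + A0"
    unfolding hm_eq using \<open>0 \<le> t1 x\<close> by simp
  have "p < t4 x" using t4_bounds[of x] assms p_less by linarith
  then have h4: "hm (t4 x) = C" unfolding hm_eq by simp
  show ?thesis
  proof (cases "x < p")
    case False
    then have "hm x = C" using assms unfolding hm_eq by simp
    then show ?thesis
      using False assms lamC split_C unfolding FP_eq h1 h4 by (simp add: add_divide_distrib)
  next
    case True
    define e where "e j = (indicator {w j..p} x :: real)" for j
    define R where "R = (\<Sum>j\<in>{1..<m}. A j * e (Suc j))"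
    define S where "S = (\<Sum>j=1..m. A j * e j)"
    have t2: "0 \<le> t2 x" "t2 x \<le> p" "1 / (2 * s2) \<le> t2 x"
      using t2_bounds[of x] assms True inv_s2 b_gt_1 by linarith+
    have t3: "1 / 2 \<le> t3 x" using t3_bounds[of x] assms True by simp
    have "(\<Sum>j=1..m. A j * indicator {w j..p} (t2 x)) = (\<Sum>j\<in>{1..<m}. A j * indicator {w j..p} (t2 x)) + A m * indicator {w m..p} (t2 x)"
    proof -
      have "{1..m} = insert m {1..<m}" using m_pos by auto
      then show ?thesis
        by (simp only: sum.insert finite_atLeastLessThan atLeastLessThan_iff less_irrefl simp_thms not_False_eq_True add.commute)
    qed
    also have "(\<Sum>j\<in>{1..<m}. A j * indicator {w j..p} (t2 x)) = R"
      unfolding R_def e_def using t2_orbit_iff[of _ x] t2 True by (intro sum.cong) (auto simp: indicator_def)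
    also have "indicator {w m..p} (t2 x) = (1::real)" using t2 orbit_last by simp
    finally have h2: "hm (t2 x) = C + A0 + R + 1" unfolding hm_eq A_m using t2 by simp
    have "(\<Sum>j=1..m. A j * indicator {w j..p} (t3 x)) = (\<Sum>j=1..m. A j * e 1)"
    proof (intro sum.cong refl)
      fix j assume "j \<in> {1..m}"
      then have "w j \<le> t3 x" using orbit(3)[of j] t3 by simp
      then show "A j * indicator {w j..p} (t3 x) = A j * e 1"
        using t3_le_p_iff[of x] True by (simp add: e_def indicator_def)
    qed
    moreover have "indicator {0..p} (t3 x) = e 1"
      using t3_le_p_iff[of x] True t3 by (simp add: e_def indicator_def)
    ultimately have h3: "hm (t3 x) = C + M * e 1"
      unfolding hm_eq M_def by (simp add: sum_distrib_right distrib_right)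
    have hx: "hm x = C + A0 + S" unfolding hm_eq S_def e_def using assms True by simp
    have "S = A 1 * e 1 + (\<Sum>j\<in>{Suc 1..m}. A j * e j)"
      unfolding S_def using m_pos by (simp add: sum.atLeast_Suc_atMost)
    also have "(\<Sum>j\<in>{Suc 1..m}. A j * e j) = (\<Sum>j\<in>{1..<m}. A (Suc j) * e (Suc j))"
      by (rule sum.reindex_bij_witness[of _ Suc "\<lambda>j. j - 1"]) auto
    finally have "q * S = q * (A 1 * e 1) + R"
      by (simp add: R_def A_Suc sum_distrib_left distrib_left mult.assoc)
    then have "lam * S = lam * (A 1 * e 1) + R / (s1 * b)"
      using s1_gt_1 b_gt_1 by (simp add: q_def field_simps)
    moreover have "lam * A0 = C / b + A0 / (s1 * b) + 1 / (s1 * b)"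
    proof -
      have "lam * A0 = lam * b * A0 / b" using b_gt_1 by simp
      also have "lam * b * A0 = C + A0 / s1 + 1 / s1" using secular by simp
      finally show ?thesis by (simp add: add_divide_distrib)
    qed
    moreover have "M * e 1 / (s2 * b) = lam * (A 1 * e 1)"
      unfolding M_def total_mass using s2_gt_1 b_gt_1 by simp
    moreover have "C / (s1 * b) + C / (s2 * b) = C / b"
    proof -
      have "C / (s1 * b) + C / (s2 * b) = C / b * (1 / s1 + 1 / s2)" by (simp add: distrib_left add_divide_distrib mult_ac)
      then show ?thesis unfolding conjugate by simp
    qed
    ultimately have "lam * hm x = (C + A0) / (2 * s2) + (C + A0 + R + 1) / (s1 * b) + (C + M * e 1) / (s2 * b) + C / (2 * s1)"
      using lamC split_C unfolding hx by (simp add: distrib_left add_divide_distrib)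
    then show ?thesis unfolding FP_eq h1 h2 h3 h4 using assms True by simp
  qed
qed

lemma hm_eigenfunction: "eigenfunction (FP s1 s2 r a) lam hm"
  unfolding eigenfunction_def
proof (intro conjI)
  show "bounded_variation_on 0 1 hm"
    unfolding hm_eq[abs_def]
    by (intro bounded_variation_on_add bounded_variation_on_const bounded_variation_on_cmult
        bounded_variation_on_sum bounded_variation_on_indicator finite_atLeastAtMost)
  have "0 < 1 / (2 * s2)" using s2_gt_1 by simp
  then have w1: "0 \<le> w 1" "w 1 < 1 / 2"
    using orbit(2,3)[of 1] m_pos by linarith+
  show "\<not> ae_eq hm (\<lambda>_. 0)"
  proof
    assume "ae_eq hm (\<lambda>_. 0)"
    then have "negligible {x \<in> {0..1}. hm x \<noteq> 0}" unfolding ae_eq_iff_negligible .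
    moreover have "{x \<in> {0..1}. hm x \<noteq> 0} = {0..1} - {x. hm x = 0}" by blast
    ultimately have neg: "negligible ({0..1} - {x. hm x = 0})" by simp
    have "w 1 < p" using w1(2) b_gt_1 by linarith
    moreover have "p \<le> 1" using b_less_2 by linarith
    ultimately obtain x where "x \<in> {x. hm x = 0}" and x: "w 1 < x" "x < p"
      by (rule conegligible_meets_interval[OF neg w1(1)])
    then have "hm x = 0" by simp
    then have "lam * b * (lam * s2 * b * A 1) = 0" using hm_plateau[OF x] plateau_height by simp
    moreover have "A 1 \<noteq> 0" using q_gt_1 unfolding A_eq by simp
    ultimately show False using lam_half s2_gt_1 b_gt_1 by simp
  qed
  have "{x \<in> {0..1}. FP s1 s2 r a hm x \<noteq> lam * hm x} \<subseteq> {0, 1, p}"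
  proof
    fix x assume x: "x \<in> {x \<in> {0..1}. FP s1 s2 r a hm x \<noteq> lam * hm x}"
    then have "\<not> (0 < x \<and> x < 1 \<and> x \<noteq> p)" using FP_hm[of x] by blast
    then show "x \<in> {0, 1, p}" using x by auto
  qed
  then show "ae_eq (FP s1 s2 r a hm) (\<lambda>x. lam * hm x)"
    unfolding ae_eq_iff_negligible by (rule negligible_subset[rotated]) simp
qed

end

section \<open>The secular equation\<close>
context markov_w_map
begin

abbreviation secular_defect :: "real \<Rightarrow> real" where
  "secular_defect lam \<equiv> c_coeff s1 s2 r a m lam - lam * b * alpha0 s1 s2 r a m lam
     + alpha0 s1 s2 r a m lam / s1 + 1 / s1"

lemma alpha0_eq:
  "alpha0 s1 s2 r a m lam =
    (lam ^ m * s1 ^ (m - 1) * b ^ m * (lam * s1 * s2 * b - s1 * s2) + 1) / (lam * s1 * b - 1)"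
  unfolding alpha0_def b_def ..

text \<open>At \<open>\<lambda> = 1 / b\<close> the power of \<open>\<lambda>\<close> in \<open>\<alpha>\<^sub>0\<close> is multiplied by \<open>0\<close>, which leaves \<open>1 / (s1 - 1)\<close>.\<close>
lemma secular_defect_upper_end: "secular_defect (1 / b) > 0"
proof -
  have al: "alpha0 s1 s2 r a m (1 / b) = 1 / (s1 - 1)"
    using b_gt_1 unfolding alpha0_eq by simp
  have c: "c_coeff s1 s2 r a m (1 / b) > 0"
    using b_less_2 b_gt_1 s1_gt_1 s2_gt_1 unfolding c_coeff_def al
    by (intro divide_pos_pos mult_pos_pos) (auto simp: field_simps)
  have "secular_defect (1 / b) = c_coeff s1 s2 r a m (1 / b) - 1 / (s1 - 1) + 1 / (s1 - 1) / s1 + 1 / s1"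
    using b_gt_1 unfolding al by simp
  also have "\<dots> = c_coeff s1 s2 r a m (1 / b)"
  proof -
    have "1 / (s1 - 1) - 1 / (s1 - 1) / s1 = (1 - 1 / s1) / (s1 - 1)" by (simp add: diff_divide_distrib)
    also have "1 - 1 / s1 = (s1 - 1) / s1" using s1_gt_1 by (simp add: diff_divide_distrib)
    also have "\<dots> / (s1 - 1) = 1 / s1" using s1_gt_1 by simp
    finally show ?thesis by linarith
  qed
  finally show ?thesis using c by simp
qed

text \<open>
  Write the defect as \<open>\<alpha>\<^sub>0 K + 1 / s1\<close>. Here \<open>K\<close> is positive and at least \<open>2 d (s2 + 4) / s2\<close>, while the
  Markov condition makes \<open>\<alpha>\<^sub>0\<close> negative and of size about \<open>\<lambda> ^ m / (2 s2 d (s1 - 1))\<close>. The factors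
  \<open>d\<close> cancel, and the product is below \<open>- 1 / s1\<close> as soon as \<open>\<lambda> ^ m\<close> satisfies \<open>power\<close>, a bound that
  stays away from \<open>1\<close> as \<open>d\<close> tends to \<open>0\<close>.
\<close>
lemma secular_defect_lower_end:
  assumes "(1 - 2 * d) * s1 > 1" "6 * d < 1"
    and power: "s2 / (s2 + 4) + 2 * s2 * d < ((1 - 2 * d) / b) ^ m"
  shows "secular_defect ((1 - 2 * d) / b) < 0"
proof -
  define lam where "lam = (1 - 2 * d) / b"
  define Y where "Y = lam ^ m"
  define \<alpha> where "\<alpha> = alpha0 s1 s2 r a m lam"
  define K where "K = 1 / (s2 * (2 * lam - 1)) - (1 - 2 * d) + 1 / s1"
  have u: "lam * b = 1 - 2 * d" using b_gt_1 by (simp add: lam_def)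
  have u': "lam * s1 * b = (1 - 2 * d) * s1" unfolding u[symmetric] by simp
  have lam_half: "2 * lam - 1 = (1 - 6 * d) / b"
    using b_gt_1 unfolding lam_def by (simp add: b_eq field_simps)
  have "lam ^ m * s1 ^ (m - 1) * b ^ m * (lam * s1 * s2 * b - s1 * s2)
      = lam ^ m * (s1 * s1 ^ (m - 1)) * b ^ m * s2 * (lam * b - 1)"
    by (simp add: algebra_simps)
  also have "s1 * s1 ^ (m - 1) = s1 ^ m" using m_pos by (cases m) auto
  also have "lam ^ m * s1 ^ m * b ^ m * s2 * (lam * b - 1) = Y * (s1 * b) ^ m * s2 * (- 2 * d)"
    unfolding u Y_def by (simp add: power_mult_distrib)
  also have "\<dots> = - (Y / (2 * s2 * d))"
    unfolding expansion_power using s2_gt_1 d_pos by (simp add: power2_eq_square)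
  finally have "\<alpha> = (1 - Y / (2 * s2 * d)) / ((1 - 2 * d) * s1 - 1)"
    unfolding \<alpha>_def alpha0_eq u' by simp
  then have \<alpha>: "\<alpha> = - ((Y / (2 * s2 * d) - 1) / ((1 - 2 * d) * s1 - 1))"
    by (metis divide_minus_left minus_diff_eq)
  have Y': "s2 / (s2 + 4) + 2 * s2 * d < Y" using power by (simp add: Y_def lam_def)
  have "0 \<le> s2 / (s2 + 4)" using s2_gt_1 by simp
  then have "2 * s2 * d < Y" using Y' by linarith
  then have N: "0 < Y / (2 * s2 * d) - 1" using s2_gt_1 d_pos by simp
  have "(Y / (2 * s2 * d) - 1) / (s1 - 1) \<le> (Y / (2 * s2 * d) - 1) / ((1 - 2 * d) * s1 - 1)"
    using N assms(1) d_pos s1_gt_1 by (intro divide_left_mono mult_pos_pos) (auto simp: algebra_simps)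
  then have alpha_le: "\<alpha> \<le> - ((Y / (2 * s2 * d) - 1) / (s1 - 1))" unfolding \<alpha> by simp
  have "K = (1 / s2) * (1 / (2 * lam - 1) - 1) + 2 * d"
    using conjugate by (simp add: K_def algebra_simps)
  moreover have "8 * d \<le> 1 / (2 * lam - 1) - 1"
  proof -
    have "1 / (2 * lam - 1) - 1 = 8 * d / (1 - 6 * d)"
      unfolding lam_half using assms(2) by (simp add: b_eq field_simps)
    moreover have "8 * d / 1 \<le> 8 * d / (1 - 6 * d)"
      using assms(2) d_pos by (intro divide_left_mono) auto
    ultimately show ?thesis by simp
  qed
  then have "(1 / s2) * (8 * d) \<le> (1 / s2) * (1 / (2 * lam - 1) - 1)"
    using s2_gt_1 by (intro mult_left_mono) auto
  ultimately have K: "2 * d * (s2 + 4) / s2 \<le> K" using s2_gt_1 by (simp add: field_simps)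
  have "1 / s1 < (Y / (2 * s2 * d) - 1) / (s1 - 1) * (2 * d * (s2 + 4) / s2)"
  proof -
    have s: "(s1 - 1) * s2 = s1" using s1_times_s2 by (simp add: algebra_simps)
    have "s2 < (Y - 2 * s2 * d) * (s2 + 4)"
      using Y' s2_gt_1 by (simp add: field_simps)
    then have "1 < (Y - 2 * s2 * d) * (s2 + 4) / s2" using s2_gt_1 by (simp add: pos_less_divide_eq)
    then have "1 / s1 < (Y - 2 * s2 * d) * (s2 + 4) / s2 / s1"
      using s1_gt_1 by (intro divide_strict_right_mono) auto
    also have "\<dots> = (Y - 2 * s2 * d) * (s2 + 4) / s2 / ((s1 - 1) * s2)" unfolding s ..
    also have "\<dots> = (Y / (2 * s2 * d) - 1) / (s1 - 1) * (2 * d * (s2 + 4) / s2)"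
      using s2_gt_1 d_pos s1_gt_1 by (simp add: field_simps)
    finally show ?thesis .
  qed
  also have "\<dots> \<le> - \<alpha> * (2 * d * (s2 + 4) / s2)"
    using alpha_le s2_gt_1 d_pos by (intro mult_right_mono) auto
  also have "\<dots> \<le> - \<alpha> * K"
  proof -
    have "0 \<le> (Y / (2 * s2 * d) - 1) / (s1 - 1)" using N s1_gt_1 by simp
    then have "0 \<le> - \<alpha>" using alpha_le by linarith
    then show ?thesis using K by (intro mult_left_mono)
  qed
  finally have "\<alpha> * K + 1 / s1 < 0" by simp
  moreover have "secular_defect lam = \<alpha> * K + 1 / s1"
    unfolding c_coeff_def \<alpha>_def[symmetric] u K_def by (simp add: algebra_simps)
  ultimately show ?thesis by (simp add: lam_def)
qed

lemma secular_root_exists: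
  assumes "(1 - 2 * d) * s1 > 1" "6 * d < 1"
    and power: "s2 / (s2 + 4) + 2 * s2 * d < ((1 - 2 * d) / b) ^ m"
  obtains lam where "(1 - 2 * d) / b < lam" "lam < 1 / b" "secular_defect lam = 0"
proof -
  let ?l = "(1 - 2 * d) / b"
  have le: "?l \<le> 1 / b" using b_gt_1 d_pos by (intro divide_right_mono) auto
  have pos: "1 / 2 < ?l" using assms(2) b_gt_1 by (simp add: b_eq field_simps)
  have den: "lam * s1 * b - 1 \<noteq> 0" "s2 * (2 * lam - 1) \<noteq> 0" if "lam \<in> {?l..1 / b}" for lam
  proof -
    have "1 < ?l * b * s1" using assms(1) b_gt_1 by simp
    also have "\<dots> \<le> lam * b * s1" using that b_gt_1 s1_gt_1 by (intro mult_right_mono) auto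
    finally show "lam * s1 * b - 1 \<noteq> 0" by (simp add: mult_ac)
    have "1 / 2 < lam" using that pos by (metis atLeastAtMost_iff less_le_trans)
    then show "s2 * (2 * lam - 1) \<noteq> 0" using s2_gt_1 by simp
  qed
  have "continuous_on {?l..1 / b} secular_defect"
    unfolding c_coeff_def alpha0_eq using den s1_gt_1
    by (intro continuous_intros) auto
  then obtain lam where lam: "?l \<le> lam" "lam \<le> 1 / b" "secular_defect lam = 0"
    using IVT'[of secular_defect ?l 0 "1 / b"] secular_defect_lower_end[OF assms] secular_defect_upper_end le
    by force
  moreover have "lam \<noteq> ?l" "lam \<noteq> 1 / b"
    using lam(3) secular_defect_lower_end[OF assms] secular_defect_upper_end by auto
  ultimately show thesis using that by force
qed

text \<open>
  Taking logarithms in the Markov condition bounds \<open>m\<close> by \<open>- 2 ln (2 s2 d) / ln s1\<close>; Bernoulli's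
  inequality with \<open>\<lambda> \<ge> 1 - 4 d\<close> does the rest.
\<close>
lemma lower_end_power_bound:
  assumes "4 * d < 1"
  shows "1 - 4 * d * (- 2 * ln (2 * s2 * d) / ln s1) \<le> ((1 - 2 * d) / b) ^ m"
proof -
  have "s1 ^ m \<le> (s1 * b) ^ m" using s1_gt_1 b_gt_1 by (intro power_mono) auto
  also have "\<dots> = 1 / (2 * s2 * d)\<^sup>2"
    by (rule expansion_power)
  finally have "ln (s1 ^ m) \<le> ln (1 / (2 * s2 * d)\<^sup>2)"
    using s1_gt_1 s2_gt_1 d_pos by (subst ln_le_cancel_iff) auto
  then have "real m * ln s1 \<le> - 2 * ln (2 * s2 * d)"
    using s1_gt_1 s2_gt_1 d_pos by (simp add: ln_realpow ln_div)
  then have "real m \<le> - 2 * ln (2 * s2 * d) / ln s1"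
    using s1_gt_1 by (metis pos_le_divide_eq ln_gt_zero)
  then have "4 * d * real m \<le> 4 * d * (- 2 * ln (2 * s2 * d) / ln s1)"
    using d_pos by (intro mult_left_mono) auto
  then have "1 - 4 * d * (- 2 * ln (2 * s2 * d) / ln s1) \<le> 1 + real m * (- 4 * d)" by (simp add: mult_ac)
  also have "\<dots> \<le> (1 + (- 4 * d)) ^ m" using assms by (intro Bernoulli_inequality) simp
  also have "\<dots> \<le> ((1 - 2 * d) / b) ^ m"
  proof (intro power_mono)
    have "(1 - 4 * d) * b = 1 - 2 * d - 8 * d\<^sup>2" by (simp add: b_eq power2_eq_square algebra_simps)
    also have "\<dots> \<le> 1 - 2 * d" by simp
    finally show "1 + - 4 * d \<le> (1 - 2 * d) / b" using b_gt_1 by (simp add: pos_le_divide_eq)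
  qed (use assms in simp)
  finally show ?thesis .
qed

end

section \<open>The eigenvalue for small parameters\<close>

text \<open>
  As \<open>a\<close> tends to \<open>0\<close> every left-hand side tends to a limit strictly below that of the right-hand
  side; in the last inequality \<open>d ln d\<close> tends to \<open>0\<close>.
\<close>
lemma small_parameter_bounds:
  fixes s1 s2 r :: real
  assumes "s1 > 1" "s2 > 1" "r > 0"
  obtains a0 where "a0 > 0"
    "\<And>a. 0 < a \<Longrightarrow> a < a0 \<Longrightarrow> 2 * s2 * r * a < 1 \<and> 6 * (r * a) < 1
      \<and> 1 < (1 - 2 * (r * a)) * s1 \<and> 1 < (1 - 2 * (r * a)) * s2
      \<and> s2 / (s2 + 4) + 2 * s2 * (r * a) < 1 - 4 * (r * a) * (- 2 * ln (2 * s2 * (r * a)) / ln s1)"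
proof -
  have "ln s1 > 0" using assms by simp
  have "((\<lambda>a. 2 * s2 * r * a) \<longlongrightarrow> 0) (at_right 0)" "((\<lambda>a. 6 * (r * a)) \<longlongrightarrow> 0) (at_right 0)"
    "((\<lambda>a. (1 - 2 * (r * a)) * s1) \<longlongrightarrow> s1) (at_right 0)"
    "((\<lambda>a. (1 - 2 * (r * a)) * s2) \<longlongrightarrow> s2) (at_right 0)"
    by (auto intro!: tendsto_eq_intros)
  note lims = order_tendstoD(2)[OF this(1), of 1] order_tendstoD(2)[OF this(2), of 1]
    order_tendstoD(1)[OF this(3), of 1] order_tendstoD(1)[OF this(4), of 1]
  have lim: "((\<lambda>a. 1 - 4 * (r * a) * (- 2 * ln (2 * s2 * (r * a)) / ln s1) - 2 * s2 * (r * a)) \<longlongrightarrow> 1) (at_right 0)"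
    using assms \<open>ln s1 > 0\<close> by real_asymp
  have "s2 / (s2 + 4) < 1" using assms by simp
  note lim' = order_tendstoD(1)[OF lim this]
  have "\<forall>\<^sub>F a in at_right 0. 2 * s2 * r * a < 1 \<and> 6 * (r * a) < 1
      \<and> 1 < (1 - 2 * (r * a)) * s1 \<and> 1 < (1 - 2 * (r * a)) * s2
      \<and> s2 / (s2 + 4) + 2 * s2 * (r * a) < 1 - 4 * (r * a) * (- 2 * ln (2 * s2 * (r * a)) / ln s1)"
    using lims(1)[OF zero_less_one] lims(2)[OF zero_less_one] lims(3)[OF assms(1)] lims(4)[OF assms(2)] lim'
    by eventually_elim auto
  then show thesis
    unfolding eventually_at_right_field using that by auto
qed

theorem theorem1:
  fixes s1 s2 r :: real
  assumes "s1 > 1" and "s2 > 1" and "1 / s1 + 1 / s2 = 1" and "r > 0"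
  shows "\<exists>a0>0. \<forall>(a::real) (m::nat).
    0 < a \<longrightarrow> a < a0 \<longrightarrow> a \<le> 1 / (2 * r) \<longrightarrow> m \<ge> 1 \<longrightarrow>
    (s1 + 2 * r * s1 * a) ^ m = 1 / (4 * r\<^sup>2 * s2\<^sup>2 * a\<^sup>2) \<longrightarrow>
    (\<exists>lam::real.
       (1 - 2 * r * a) / (1 + 2 * r * a) < lam \<and> lam < 1 / (1 + 2 * r * a) \<and>
       eigenvalue (FP s1 s2 r a) lam \<and>
       eigenfunction (FP s1 s2 r a) lam (h s1 s2 r a m lam) \<and>
       (\<forall>f. eigenfunction (FP s1 s2 r a) lam f \<longrightarrow>
          (\<exists>k. ae_eq f (\<lambda>x. k * h s1 s2 r a m lam x))) \<and>
       c_coeff s1 s2 r a m lam =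
         lam * (1 + 2 * r * a) * alpha0 s1 s2 r a m lam - alpha0 s1 s2 r a m lam / s1 - 1 / s1)"
proof -
  obtain a0 where a0: "a0 > 0"
    "\<And>a. 0 < a \<Longrightarrow> a < a0 \<Longrightarrow> 2 * s2 * r * a < 1 \<and> 6 * (r * a) < 1
      \<and> 1 < (1 - 2 * (r * a)) * s1 \<and> 1 < (1 - 2 * (r * a)) * s2
      \<and> s2 / (s2 + 4) + 2 * s2 * (r * a) < 1 - 4 * (r * a) * (- 2 * ln (2 * s2 * (r * a)) / ln s1)"
    using small_parameter_bounds[OF assms(1,2,4)] by metis
  show ?thesis
  proof (rule exI[of _ a0], intro conjI a0(1) allI impI)
    fix a :: real and m :: nat
    assume a: "0 < a" "a < a0" and m: "1 \<le> m"
      and eq: "(s1 + 2 * r * s1 * a) ^ m = 1 / (4 * r\<^sup>2 * s2\<^sup>2 * a\<^sup>2)"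
    interpret w_map s1 s2 r a
      using assms a a0(2)[OF a] by unfold_locales auto
    interpret markov_w_map s1 s2 r a m
      using m eq assms(2,4) a(1) unfolding slope_eq by unfold_locales (simp_all add: field_simps)
    have small: "6 * d < 1" "1 < (1 - 2 * d) * s1" "1 < (1 - 2 * d) * s2"
      "s2 / (s2 + 4) + 2 * s2 * d < 1 - 4 * d * (- 2 * ln (2 * s2 * d) / ln s1)"
      using a0(2)[OF a] unfolding d_def by blast+
    have "4 * d < 1" using small(1) d_pos by linarith
    then have "s2 / (s2 + 4) + 2 * s2 * d < ((1 - 2 * d) / b) ^ m"
      using small(4) lower_end_power_bound by linarith
    then obtain lam where lam: "(1 - 2 * d) / b < lam" "lam < 1 / b" "secular_defect lam = 0"
      using secular_root_exists small(1,2) by blast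
    have lamb: "1 - 2 * d < lam * b" using lam(1) b_gt_1 by (simp add: pos_divide_less_eq)
    have lam_s1: "1 < lam * b * s1" and lam_s2: "1 < lam * b * s2"
      using lamb small(2,3) s1_gt_1 s2_gt_1
      by (meson less_trans mult_strict_right_mono zero_less_one)+
    interpret markov_w_eigenvalue s1 s2 r a m lam
    proof
      show "1 < lam * s1 * b" using lam_s1 by (simp add: mult_ac)
      have "1 / 2 < (1 - 2 * d) / b" using small(1) b_gt_1 by (simp add: b_eq field_simps)
      then show "1 / 2 < lam" using lam(1) by linarith
      show "c_coeff s1 s2 r a m lam =
          lam * b * alpha0 s1 s2 r a m lam - alpha0 s1 s2 r a m lam / s1 - 1 / s1" using lam(3) by linarith
    qed
    have unique: "\<exists>k. ae_eq f (\<lambda>x. k * hm x)" if "eigenfunction (FP s1 s2 r a) lam f" for f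
    proof (rule eigenfunction_unique[OF that hm_eigenfunction])
      show "w 1 < 1 / 2" using orbit(3)[of 1] m_pos by simp
      show "1 / 2 < p" using b_gt_1 by simp
      show "hm x = C + lam * s2 * b * A 1" if "w 1 < x" "x < p" for x using hm_plateau that .
      have "A 1 \<noteq> 0" using q_gt_1 unfolding A_eq by simp
      then show "C + lam * s2 * b * A 1 \<noteq> 0"
        unfolding plateau_height using lam_half s2_gt_1 b_gt_1 by simp
      show "1 / (s1 * b) < lam" "1 / (s2 * b) < lam"
        using lam_s1 lam_s2 slopes_pos by (simp_all add: pos_divide_less_eq mult_ac)
    qed
    have two_d: "2 * r * a = 2 * d" by (simp add: d_def)
    show "\<exists>lam::real.
       (1 - 2 * r * a) / (1 + 2 * r * a) < lam \<and> lam < 1 / (1 + 2 * r * a) \<and>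
       eigenvalue (FP s1 s2 r a) lam \<and>
       eigenfunction (FP s1 s2 r a) lam (h s1 s2 r a m lam) \<and>
       (\<forall>f. eigenfunction (FP s1 s2 r a) lam f \<longrightarrow>
          (\<exists>k. ae_eq f (\<lambda>x. k * h s1 s2 r a m lam x))) \<and>
       c_coeff s1 s2 r a m lam =
         lam * (1 + 2 * r * a) * alpha0 s1 s2 r a m lam - alpha0 s1 s2 r a m lam / s1 - 1 / s1"
      using lam(1,2) hm_eigenfunction unique secular
      unfolding two_d b_eq[symmetric] eigenvalue_def by blast
  qed
qed

end
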